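(* Let $(W,S)$ be an (irreducible) affine Coxeter system with set of reflections $T$. Then there exist an integer $M\ge 1$ and a palindromic polynomial $P(q)$ such that $$T(q):=\sum_{t\in T}q^{\ell(t)}=q\,\frac{P(q^2)}{1-q^{2M}}.$$
   Context: $\ell$ is the length function of $(W,S)$ and $T=\bigcup_{w\in W}wSw^{-1}$. An affine Coxeter system is here the affine Weyl group of a reduced irreducible crystallographic finite root system, with its standard simple reflections. A polynomial $P(q)$ of degree $d$ is palindromic if $q^dP(q^{-1})=P(q)$. The identity is between formal power series in $q$. *)

theory Defs
  imports
    "HOL-Analysis.Analysis"
    "HOL-Algebra.Bij"
    "HOL-Algebra.Generated_Groups"
    "HOL-Computational_Algebra.Computational_Algebra"
begin

section \<open>Finite root systems\<close>

definition affine_reflection :: "'a::real_inner \<Rightarrow> real \<Rightarrow> 'a \<Rightarrow> 'a" where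
  "affine_reflection \<alpha> k x = x - ((x \<bullet> \<alpha> - k) * 2 / (\<alpha> \<bullet> \<alpha>)) *\<^sub>R \<alpha>"

definition root_system :: "'a::euclidean_space set \<Rightarrow> bool" where
  "root_system \<Phi> \<longleftrightarrow>
     finite \<Phi> \<and> span \<Phi> = UNIV \<and> 0 \<notin> \<Phi> \<and>
     (\<forall>\<alpha>\<in>\<Phi>. \<forall>\<beta>\<in>\<Phi>. affine_reflection \<alpha> 0 \<beta> \<in> \<Phi>)"

definition reduced_roots :: "'a::euclidean_space set \<Rightarrow> bool" where
  "reduced_roots \<Phi> \<longleftrightarrow> (\<forall>\<alpha>\<in>\<Phi>. \<forall>c. c *\<^sub>R \<alpha> \<in> \<Phi> \<longrightarrow> c = 1 \<or> c = -1)"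

definition crystallographic :: "'a::euclidean_space set \<Rightarrow> bool" where
  "crystallographic \<Phi> \<longleftrightarrow> (\<forall>\<alpha>\<in>\<Phi>. \<forall>\<beta>\<in>\<Phi>. 2 * (\<beta> \<bullet> \<alpha>) / (\<alpha> \<bullet> \<alpha>) \<in> \<int>)"

definition irreducible_roots :: "'a::euclidean_space set \<Rightarrow> bool" where
  "irreducible_roots \<Phi> \<longleftrightarrow>
     \<Phi> \<noteq> {} \<and>
     \<not> (\<exists>A B. A \<noteq> {} \<and> B \<noteq> {} \<and> A \<inter> B = {} \<and> A \<union> B = \<Phi> \<and>
            (\<forall>\<alpha>\<in>A. \<forall>\<beta>\<in>B. \<alpha> \<bullet> \<beta> = 0))"

definition nonneg_combinations :: "'a::euclidean_space set \<Rightarrow> 'a set" where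
  "nonneg_combinations \<Delta> = {\<Sum>\<alpha>\<in>\<Delta>. real (c \<alpha>) *\<^sub>R \<alpha> | c :: 'a \<Rightarrow> nat. True}"

definition simple_system :: "'a::euclidean_space set \<Rightarrow> 'a set \<Rightarrow> bool" where
  "simple_system \<Phi> \<Delta> \<longleftrightarrow>
     \<Delta> \<subseteq> \<Phi> \<and> independent \<Delta> \<and>
     (\<forall>\<beta>\<in>\<Phi>. \<beta> \<in> nonneg_combinations \<Delta> \<or> - \<beta> \<in> nonneg_combinations \<Delta>)"

definition highest_root :: "'a::euclidean_space set \<Rightarrow> 'a set \<Rightarrow> 'a \<Rightarrow> bool" where
  "highest_root \<Phi> \<Delta> \<theta> \<longleftrightarrow> \<theta> \<in> \<Phi> \<and> (\<forall>\<beta>\<in>\<Phi>. \<theta> - \<beta> \<in> nonneg_combinations \<Delta>)"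

section \<open>Affine Coxeter systems\<close>

definition affine_weyl_group :: "'a::euclidean_space set \<Rightarrow> ('a \<Rightarrow> 'a) monoid" where
  "affine_weyl_group \<Phi> =
     BijGroup UNIV \<lparr>carrier := generate (BijGroup UNIV)
       {affine_reflection \<alpha> (real_of_int k) | \<alpha> k. \<alpha> \<in> \<Phi>}\<rparr>"

text \<open>The simple affine reflections are the reflections in the walls of the fundamental alcove
  \<open>{x. (\<forall>\<alpha>\<in>\<Delta>. 0 < x \<bullet> \<alpha>) \<and> x \<bullet> \<theta> < 1}\<close>.\<close>

definition simple_affine_reflections ::
    "'a::euclidean_space set \<Rightarrow> 'a \<Rightarrow> ('a \<Rightarrow> 'a) set" where
  "simple_affine_reflections \<Delta> \<theta> =
     insert (affine_reflection \<theta> 1) ((\<lambda>\<alpha>. affine_reflection \<alpha> 0) ` \<Delta>)"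

definition affine_coxeter_system ::
    "('a::euclidean_space \<Rightarrow> 'a) monoid \<Rightarrow> ('a \<Rightarrow> 'a) set \<Rightarrow> bool" where
  "affine_coxeter_system W S \<longleftrightarrow>
     (\<exists>\<Phi> \<Delta> \<theta>. root_system \<Phi> \<and> reduced_roots \<Phi> \<and> crystallographic \<Phi> \<and> irreducible_roots \<Phi> \<and>
        simple_system \<Phi> \<Delta> \<and> highest_root \<Phi> \<Delta> \<theta> \<and>
        W = affine_weyl_group \<Phi> \<and> S = simple_affine_reflections \<Delta> \<theta>)"

section \<open>Length and reflections\<close>

text \<open>Words use only letters of \<open>S\<close> and no inverses, since Coxeter generators are involutions.\<close>

definition coxeter_length :: "('g, 'b) monoid_scheme \<Rightarrow> 'g set \<Rightarrow> 'g \<Rightarrow> nat" where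
  "coxeter_length W S w =
     (LEAST n. \<exists>ss. length ss = n \<and> set ss \<subseteq> S \<and> foldr (mult W) ss (one W) = w)"

definition coxeter_reflections :: "('g, 'b) monoid_scheme \<Rightarrow> 'g set \<Rightarrow> 'g set" where
  "coxeter_reflections W S =
     (\<Union>w\<in>carrier W. (\<lambda>s. w \<otimes>\<^bsub>W\<^esub> s \<otimes>\<^bsub>W\<^esub> inv\<^bsub>W\<^esub> w) ` S)"

section \<open>Palindromic polynomials\<close>

text \<open>\<open>reflect_poly P\<close> is \<open>q\<^sup>d P(q\<^sup>-\<^sup>1)\<close> with \<open>d\<close> the degree of \<open>P\<close>.\<close>

definition palindromic :: "'a::zero poly \<Rightarrow> bool" where
  "palindromic P \<longleftrightarrow> reflect_poly P = P"

end

(*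
For a positive root \<alpha> let N be the sum of |<\<beta>, \<alpha>^v>| over the positive roots \<beta>, and let L be the
number of positive roots that the reflection in \<alpha> makes negative. Counting inversions, the
reflection in the zero set of x \<mapsto> \<alpha>.x + k has length kN + L if k \<ge> 0, and |k|N - L if k < 0. Hence
the reflections of length n attached to \<alpha> number [n = L mod N] + [n = -L mod N]. A reflection
has an odd number of inversions, which gives L odd and N even. If 2M is a common multiple of all N,
then the number of reflections of length n vanishes for even n, is 2M-periodic, and is symmetric
under n \<mapsto> 2M - n; this is the asserted form of the generating function. The constant term of P counts
the simple reflections, so P is nonzero at 0, as the palindromic property requires.
*)
theory Submission
  imports Defs
begin

section \<open>Counting and generating functions\<close>

text \<open>Length is defined by shortest words, the count by roots. The bridge is the exchange
  argument, carried out directly on affine roots: each has coefficients of one sign with respect to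
  the functions vanishing on the alcove walls, and a simple reflection negates exactly one positive
  root. Neither a presentation of W nor the geometry of the other alcoves enters. Reflections act
  linearly on affine functions by precomposition, so an equation between words turns into an
  equation between functions. Each reflection of W belongs to exactly one positive affine root,
  which turns the sum over T into a sum over roots. A root (\<alpha>, k) with k < 0 is never
  positive: that reflection is represented by (- \<alpha>, -k), whence two families of roots and two
  congruences modulo N for each \<alpha>. The delicate point is the start of the sequence. Level 0
  is positive in one family only, and the numerator P has no correction term only if the count is
  periodic from n = 0 on. This holds because 0 < L < N, so that a congruence alone forces the level
  to be admissible; the inequalities in turn come from parity, an odd number of inversions being
  nonzero.\<close>

lemma odd_card_involution:
  assumes "finite A" "\<And>x. x \<in> A \<Longrightarrow> f x \<in> A" "\<And>x. x \<in> A \<Longrightarrow> f (f x) = x"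
    and "a \<in> A" "\<And>x. x \<in> A \<Longrightarrow> f x = x \<longleftrightarrow> x = a"
  shows "odd (card A)"
proof -
  have even: "even (card B)"
    if "finite B" "\<And>x. x \<in> B \<Longrightarrow> f x \<in> B" "\<And>x. x \<in> B \<Longrightarrow> f (f x) = x" "\<And>x. x \<in> B \<Longrightarrow> f x \<noteq> x"
    for B
    using that
  proof (induction "card B" arbitrary: B rule: less_induct)
    case less
    show ?case
    proof (cases "B = {}")
      case False
      then obtain x where x: "x \<in> B" by auto
      have 2: "card {x, f x} = 2" using less.prems(4)[OF x] by simp
      have sub: "{x, f x} \<subseteq> B" using x less.prems by auto
      have c: "card B = card (B - {x, f x}) + 2"
        using sub 2 less.prems(1) card_Diff_subset[of "{x, f x}" B] card_mono[of B "{x, f x}"] by simp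
      have "even (card (B - {x, f x}))"
      proof (rule less.hyps)
        show "card (B - {x, f x}) < card B" using c by simp
        show "finite (B - {x, f x})" using less.prems(1) by simp
        fix y assume y: "y \<in> B - {x, f x}"
        then have yB: "y \<in> B" by simp
        show "f (f y) = y" "f y \<noteq> y" by (rule less.prems yB)+
        have "f y \<noteq> x"
        proof
          assume "f y = x"
          from arg_cong[OF this, of f] have "y = f x" by (simp only: less.prems(3)[OF yB])
          with y show False by blast
        qed
        moreover have "f y \<noteq> f x"
        proof
          assume "f y = f x"
          from arg_cong[OF this, of f] have "y = x"
            by (simp only: less.prems(3)[OF yB] less.prems(3)[OF x])
          with y show False by blast
        qed
        ultimately show "f y \<in> B - {x, f x}" using less.prems(2)[OF yB] by simp
      qed
      then show ?thesis using c by simp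
    qed simp
  qed
  have "even (card (A - {a}))"
  proof (rule even)
    show "finite (A - {a})" using assms(1) by simp
    fix x assume x: "x \<in> A - {a}"
    then have xA: "x \<in> A" by simp
    show "f (f x) = x" by (rule assms(3)[OF xA])
    show "f x \<noteq> x" using assms(5)[OF xA] x by simp
    have "f a = a" using assms(5)[OF assms(4)] by simp
    have "f x \<noteq> a"
    proof
      assume "f x = a"
      from arg_cong[OF this, of f] have "x = a" by (simp only: assms(3)[OF xA] \<open>f a = a\<close>)
      with x show False by blast
    qed
    then show "f x \<in> A - {a}" using assms(2)[OF xA] by simp
  qed
  then show ?thesis unfolding card.remove[OF assms(1,4)] by simp
qed

text \<open>In the topology of formal power series each coefficient has to become constant
  eventually; the n-th one is settled once a finite subset contains all t with
  \<open>l t = n\<close>.\<close>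

lemma has_sum_fps_X_power:
  fixes l :: "'t \<Rightarrow> nat"
  assumes fin: "\<And>n. finite {t\<in>T. l t = n}"
  shows "((\<lambda>t. fps_X ^ l t :: 'a::comm_ring_1 fps) has_sum
           Abs_fps (\<lambda>n. of_nat (card {t\<in>T. l t = n}))) T"
  unfolding has_sum_def
proof (rule tendsto_fpsI)
  fix n
  show "\<forall>\<^sub>F X in finite_subsets_at_top T.
      fps_nth (\<Sum>t\<in>X. fps_X ^ l t) n
        = fps_nth (Abs_fps (\<lambda>n. of_nat (card {t\<in>T. l t = n})) :: 'a fps) n"
    unfolding eventually_finite_subsets_at_top
  proof (intro exI[of _ "{t\<in>T. l t = n}"] conjI allI impI fin)
    fix Y assume Y: "finite Y \<and> {t \<in> T. l t = n} \<subseteq> Y \<and> Y \<subseteq> T"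
    then have "{t\<in>Y. n = l t} = {t\<in>T. l t = n}" by auto
    with Y show "fps_nth (\<Sum>t\<in>Y. fps_X ^ l t) n
        = fps_nth (Abs_fps (\<lambda>n. of_nat (card {t\<in>T. l t = n})) :: 'a fps) n"
      by (simp add: fps_sum_nth fps_X_power_iff flip: sum.inter_filter)
  qed auto
qed

text \<open>Multiplying by 1 - X^(2M) cuts the periodic sequence down to its first period, whose odd
  places are the coefficients of P. The symmetry n \<mapsto> 2M - n exchanges the places 2j + 1 and
  2(M - 1 - j) + 1.\<close>

lemma palindromic_quotient_of_symmetric_sequence:
  fixes c :: "nat \<Rightarrow> nat"
  assumes M: "M \<ge> 1"
    and c_even: "\<And>n. even n \<Longrightarrow> c n = 0"
    and period: "\<And>n. c (n + 2 * M) = c n"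
    and symm: "\<And>n. n \<le> 2 * M \<Longrightarrow> c (2 * M - n) = c n"
    and c1: "c 1 \<noteq> 0"
  shows "\<exists>P::int poly. palindromic P \<and>
    Abs_fps (\<lambda>n. of_nat (c n)) =
      (fps_X * (fps_of_poly (map_poly rat_of_int P) oo fps_X ^ 2) / (1 - fps_X ^ (2 * M)) :: rat fps)"
proof -
  define P where "P = (\<Sum>j<M. monom (int (c (2 * j + 1))) j)"
  have coeff: "coeff P j = (if j < M then int (c (2 * j + 1)) else 0)" for j
    by (simp add: P_def coeff_sum)
  have "2 * M - 1 = 2 * (M - 1) + 1" using M by simp
  then have last: "c (2 * (M - 1) + 1) = c 1"
    using symm[of 1] M by simp
  \<comment> \<open>\<open>reflect_poly\<close> reverses about the true degree, which must therefore
    be exactly M - 1; the top coefficient is c (2M - 1) = c 1, nonzero by hypothesis.\<close>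
  have deg: "degree P = M - 1"
  proof (rule antisym)
    show "degree P \<le> M - 1" by (rule degree_le) (auto simp: coeff)
    show "M - 1 \<le> degree P"
      using M c1 last by (intro le_degree) (simp add: coeff)
  qed
  have "coeff (reflect_poly P) j = coeff P j" for j
  proof (cases "j < M")
    case True
    have "2 * M - (2 * j + 1) = 2 * (M - 1 - j) + 1" using True by simp
    then have "c (2 * (M - 1 - j) + 1) = c (2 * j + 1)"
      using symm[of "2 * j + 1"] True by simp
    then show ?thesis using True by (simp add: coeff_reflect_poly deg coeff)
  qed (auto simp: coeff_reflect_poly deg coeff)
  then have pal: "palindromic P" by (simp add: palindromic_def poly_eq_iff)
  let ?A = "Abs_fps (\<lambda>n. of_nat (c n)) :: rat fps"
  let ?Q = "fps_of_poly (map_poly rat_of_int P) oo fps_X ^ 2"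
  have Q: "fps_nth ?Q n = (if even n then rat_of_int (coeff P (n div 2)) else 0)" for n
  proof -
    have "fps_nth ?Q n = (\<Sum>i=0..n. if 2 * i = n then rat_of_int (coeff P i) else 0)"
      unfolding fps_compose_nth power_mult[symmetric] fps_X_power_nth
      by (intro sum.cong) (auto simp: coeff_map_poly)
    also have "\<dots> = (if even n then rat_of_int (coeff P (n div 2)) else 0)"
    proof (cases "even n")
      case True
      then have "(2 * i = n) = (i = n div 2)" for i by auto
      then show ?thesis using True by simp
    next
      case False
      then have "2 * i \<noteq> n" for i by auto
      then show ?thesis using False by simp
    qed
    finally show ?thesis .
  qed
  have "?A * (1 - fps_X ^ (2 * M)) = fps_X * ?Q"
  proof (rule fps_ext)
    fix n
    have lhs: "fps_nth (?A * (1 - fps_X ^ (2 * M))) n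
        = of_nat (c n) - (if n < 2 * M then 0 else of_nat (c (n - 2 * M)))"
      by (simp add: right_diff_distrib fps_X_power_mult_right_nth)
    show "fps_nth (?A * (1 - fps_X ^ (2 * M))) n = fps_nth (fps_X * ?Q) n"
    proof (cases "n < 2 * M")
      case True
      show ?thesis
      proof (cases "even n")
        case True
        then have "fps_nth (fps_X * ?Q) n = 0" by (cases n) (auto simp: Q)
        then show ?thesis using c_even[OF True] \<open>n < 2 * M\<close> by (simp only: lhs) simp
      next
        case False
        then obtain j where "n = 2 * j + 1" by (rule oddE)
        then have "fps_nth (fps_X * ?Q) n = of_nat (c n)" using \<open>n < 2 * M\<close> by (simp add: Q coeff)
        then show ?thesis using \<open>n < 2 * M\<close> by (simp only: lhs) simp
      qed
    next
      case False
      then have "c (n - 2 * M) = c n" using period[of "n - 2 * M"] by simp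
      then have "fps_nth (?A * (1 - fps_X ^ (2 * M))) n = 0" using False by (simp add: lhs)
      also have "fps_nth (fps_X * ?Q) n = 0"
      proof (cases "even n")
        case True
        then show ?thesis by (cases n) (auto simp: Q)
      next
        case odd: False
        then obtain j where "n = 2 * j + 1" by (rule oddE)
        then show ?thesis using False by (simp add: Q coeff)
      qed
      finally show ?thesis by simp
    qed
  qed
  moreover have "(1 - fps_X ^ (2 * M) :: rat fps) \<noteq> 0"
  proof
    assume eq: "(1 - fps_X ^ (2 * M) :: rat fps) = 0"
    have "fps_nth (1 - fps_X ^ (2 * M) :: rat fps) 0 = 0" by (simp only: eq fps_zero_nth)
    then show False using M by (simp only: fps_sub_nth fps_X_power_nth) simp
  qed
  ultimately have "?A = fps_X * ?Q / (1 - fps_X ^ (2 * M))"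
    using nonzero_mult_div_cancel_right[of "1 - fps_X ^ (2 * M)" ?A] by simp
  with pal show ?thesis by blast
qed

section \<open>Affine functions and affine reflections\<close>

text \<open>The Cartan number <\<beta>, \<alpha>^v>, with the root that supplies the coroot as first
  argument.\<close>

definition pairing :: "'a::real_inner \<Rightarrow> 'a \<Rightarrow> real" where
  "pairing \<alpha> \<beta> = 2 * (\<beta> \<bullet> \<alpha>) / (\<alpha> \<bullet> \<alpha>)"

text \<open>A pair \<open>(\<alpha>, k)\<close> stands for the affine function \<open>x \<mapsto> \<alpha> \<bullet> x + k\<close>.\<close>

definition ev :: "'a::real_inner \<times> real \<Rightarrow> 'a \<Rightarrow> real" where
  "ev b x = fst b \<bullet> x + snd b"

text \<open>The function \<alpha> \<bullet> x + k vanishes where x \<bullet> \<alpha> = -k, hence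
  the sign.\<close>

definition reflection :: "'a::real_inner \<times> real \<Rightarrow> 'a \<Rightarrow> 'a" where
  "reflection a = affine_reflection (fst a) (- snd a)"

text \<open>\<open>act a b\<close> is the affine function \<open>b\<close> composed with the reflection in \<open>a\<close>. Being
  precomposition, it turns a word into the left-to-right \<open>fold\<close>.\<close>

definition act :: "'a::real_inner \<times> real \<Rightarrow> 'a \<times> real \<Rightarrow> 'a \<times> real" where
  "act a b = b - pairing (fst a) (fst b) *\<^sub>R a"

definition word :: "('a::real_inner \<times> real) list \<Rightarrow> 'a \<Rightarrow> 'a" where
  "word as = foldr (\<lambda>a f. reflection a \<circ> f) as id"

lemma reflection_eq: "reflection a x = x - (2 * ev a x / (fst a \<bullet> fst a)) *\<^sub>R fst a"
  by (simp add: reflection_def affine_reflection_def ev_def inner_commute mult.commute)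

lemma ev_uminus: "ev (- a) x = - ev a x"
  by (simp add: ev_def)

lemma reflection_uminus: "reflection (- a) = reflection a"
  by (rule ext) (simp add: reflection_eq ev_uminus)

lemma ev_reflection: "ev b (reflection a x) = ev (act a b) x"
  by (simp add: reflection_eq act_def ev_def pairing_def algebra_simps inner_simps add_divide_distrib)

lemma ev_word: "ev b (word as x) = ev (fold act as b) x"
  by (induction as arbitrary: b) (simp_all add: word_def ev_reflection)

lemma ev_inject:
  assumes "\<And>x. ev a x = ev b x" shows "a = b"
proof -
  have "snd a = snd b" using assms[of 0] by (simp add: ev_def)
  moreover from this have "\<forall>x. fst a \<bullet> x = fst b \<bullet> x" using assms by (simp add: ev_def)
  then have "fst a = fst b" by (rule vector_eq_rdot[THEN iffD1])
  ultimately show ?thesis by (simp add: prod_eq_iff)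
qed

text \<open>Makes every notion defined through \<open>fold act\<close> depend on the group element
  only, not on the word that spells it.\<close>

lemma fold_act_eq_of_word_eq:
  assumes "word as = word bs" shows "fold act as b = fold act bs b"
  by (rule ev_inject) (simp add: assms flip: ev_word)

lemma word_Nil [simp]: "word [] = id"
  and word_Cons [simp]: "word (a # as) = reflection a \<circ> word as"
  by (simp_all add: word_def)

lemma word_append: "word (as @ bs) = word as \<circ> word bs"
  by (induction as) auto

lemma act_uminus: "act a (- b) = - act a b"
  by (simp add: act_def pairing_def)

lemma fold_act_uminus: "fold act as (- b) = - fold act as b"
  by (induction as arbitrary: b) (simp_all add: act_uminus)

lemma act_self: "fst a \<noteq> 0 \<Longrightarrow> act a a = - a"
  by (simp add: act_def pairing_def scaleR_2)

lemma act_act: "fst a \<noteq> 0 \<Longrightarrow> act a (act a b) = b"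
  by (simp add: act_def pairing_def inner_simps algebra_simps add_divide_distrib diff_divide_distrib)

lemma reflection_reflection: "fst a \<noteq> 0 \<Longrightarrow> reflection a (reflection a x) = x"
  by (simp add: reflection_eq[of a "reflection a x"] ev_reflection act_self ev_uminus) (simp add: reflection_eq)

text \<open>Precomposition with an involution moves the zero set of a function by that involution.
  In the computation, \<open>norm\<close> says that the gradient keeps its length and
  \<open>shift\<close> that the linear part of \<open>reflection c\<close> takes the gradient of
  \<open>a\<close> to that of \<open>act c a\<close>.\<close>

lemma reflection_act:
  assumes "fst c \<noteq> 0"
  shows "reflection (act c a) = reflection c \<circ> reflection a \<circ> reflection c"
proof
  fix x
  have norm: "fst (act c a) \<bullet> fst (act c a) = fst a \<bullet> fst a"
    using assms by (simp add: act_def pairing_def inner_simps field_simps inner_commute[of "fst c" "fst a"])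
  have shift: "reflection c (y - t *\<^sub>R fst a) = reflection c y - t *\<^sub>R fst (act c a)" for y t
    by (simp add: reflection_eq ev_def act_def pairing_def inner_simps algebra_simps
        add_divide_distrib diff_divide_distrib inner_commute)
  show "reflection (act c a) x = (reflection c \<circ> reflection a \<circ> reflection c) x"
    using assms by (simp add: reflection_eq[of a] reflection_eq[of "act c a"] shift reflection_reflection norm ev_reflection)
qed

lemma bij_reflection: "fst a \<noteq> 0 \<Longrightarrow> bij (reflection a)"
  by (rule o_bij[of "reflection a"]) (auto simp: reflection_reflection)

lemma word_rev:
  assumes "\<And>a. a \<in> set as \<Longrightarrow> fst a \<noteq> 0"
  shows "word as \<circ> word (rev as) = id"
  using assms
  by (induction as) (auto simp: word_append fun_eq_iff reflection_reflection)

text \<open>Conjugation composes the function with the inverse word, so the last letter acts first: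
  \<open>foldr\<close> here, against \<open>fold\<close> in \<open>ev_word\<close>.\<close>

lemma word_conjugate:
  assumes "\<And>a. a \<in> set as \<Longrightarrow> fst a \<noteq> 0"
  shows "word as \<circ> reflection a \<circ> word (rev as) = reflection (foldr act as a)"
  using assms
proof (induction as)
  case (Cons c as)
  have IH: "word as \<circ> reflection a \<circ> word (rev as) = reflection (foldr act as a)"
    by (rule Cons.IH) (simp add: Cons.prems)
  have "word (c # as) \<circ> reflection a \<circ> word (rev (c # as)) = reflection c \<circ> (word as \<circ> reflection a \<circ> word (rev as)) \<circ> reflection c"
    by (simp add: word_append comp_assoc)
  also have "\<dots> = reflection c \<circ> reflection (foldr act as a) \<circ> reflection c"
    by (simp only: IH)
  also have "\<dots> = reflection (act c (foldr act as a))"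
    by (rule reflection_act[symmetric]) (simp add: Cons.prems)
  also have "act c (foldr act as a) = foldr act (c # as) a" by simp
  finally show ?case .
qed (simp add: fun_eq_iff)

lemma bij_Bij: "Bij UNIV = {f. bij f}"
  by (auto simp: Bij_def)

lemma mult_BijGroup: "bij f \<Longrightarrow> bij g \<Longrightarrow> f \<otimes>\<^bsub>BijGroup UNIV\<^esub> g = f \<circ> g"
  by (simp add: BijGroup_def bij_Bij fun_eq_iff compose_def)

lemma one_BijGroup: "\<one>\<^bsub>BijGroup UNIV\<^esub> = id"
  by (simp add: BijGroup_def fun_eq_iff)

text \<open>The multiplication of \<open>BijGroup\<close> is composition on bijections only, so
  bijectivity has to be carried through the induction.\<close>

lemma foldr_mult_BijGroup:
  assumes "set fs \<subseteq> Collect bij"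
  shows "foldr (mult (BijGroup UNIV)) fs id = foldr (\<circ>) fs id \<and> bij (foldr (\<circ>) fs id)"
  using assms by (induction fs) (auto simp: mult_BijGroup bij_comp)

lemma word_conv_foldr: "word as = foldr (\<circ>) (map reflection as) id"
  by (induction as) auto

section \<open>Affine roots\<close>

locale affine_root_datum =
  fixes \<Phi> \<Delta> :: "'a::euclidean_space set" and \<theta> :: 'a
  assumes root_system: "root_system \<Phi>" and reduced: "reduced_roots \<Phi>"
    and crystallographic: "crystallographic \<Phi>" and nonempty: "\<Phi> \<noteq> {}"
    and simple_system: "simple_system \<Phi> \<Delta>" and highest_root: "highest_root \<Phi> \<Delta> \<theta>"
begin

abbreviation coef :: "'a \<Rightarrow> 'a \<Rightarrow> real" where
  "coef \<delta> v \<equiv> representation \<Delta> v \<delta>"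

text \<open>The coefficients of \<open>b\<close> in the basis of simple affine roots are \<open>affine_coef \<delta> b\<close> at
  \<open>(\<delta>, 0)\<close> and \<open>snd b\<close> at \<open>(- \<theta>, 1)\<close>.\<close>

definition affine_coef :: "'a \<Rightarrow> 'a \<times> real \<Rightarrow> real" where
  "affine_coef \<delta> b = coef \<delta> (fst b + snd b *\<^sub>R \<theta>)"

definition pos_roots :: "'a set" where
  "pos_roots = {\<beta> \<in> \<Phi>. \<forall>\<delta>\<in>\<Delta>. 0 \<le> coef \<delta> \<beta>}"

definition affine_roots :: "('a \<times> real) set" where
  "affine_roots = \<Phi> \<times> \<int>"

definition pos_affine :: "('a \<times> real) set" where
  "pos_affine = {b \<in> affine_roots. 0 \<le> snd b \<and> (\<forall>\<delta>\<in>\<Delta>. 0 \<le> affine_coef \<delta> b)}"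

text \<open>Signs are chosen so that these functions vanish on the walls of the fundamental alcove
  and are positive inside it; the pair (- \<theta>, 1) is 1 - \<theta> \<bullet> x.\<close>

definition simple_affine :: "('a \<times> real) set" where
  "simple_affine = insert (- \<theta>, 1) ((\<lambda>\<delta>. (\<delta>, 0)) ` \<Delta>)"

definition height :: "'a \<times> real \<Rightarrow> real" where
  "height b = snd b + (\<Sum>\<delta>\<in>\<Delta>. affine_coef \<delta> b)"

section \<open>Finite roots: coefficients, signs and the highest root\<close>

lemma finite_roots: "finite \<Phi>" and zero_notin_roots: "0 \<notin> \<Phi>"
  and reflect_root: "\<And>\<alpha> \<beta>. \<alpha> \<in> \<Phi> \<Longrightarrow> \<beta> \<in> \<Phi> \<Longrightarrow> \<beta> - pairing \<alpha> \<beta> *\<^sub>R \<alpha> \<in> \<Phi>"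
  using root_system by (auto simp: root_system_def affine_reflection_def pairing_def mult.commute)

lemma uminus_root: "\<alpha> \<in> \<Phi> \<Longrightarrow> - \<alpha> \<in> \<Phi>"
  using reflect_root[of \<alpha> \<alpha>] zero_notin_roots by (cases "\<alpha> = 0") (auto simp: pairing_def scaleR_2)

lemma reduced_root: "\<alpha> \<in> \<Phi> \<Longrightarrow> c *\<^sub>R \<alpha> \<in> \<Phi> \<Longrightarrow> c = 1 \<or> c = -1"
  using reduced by (auto simp: reduced_roots_def)

lemma pairing_Ints: "\<alpha> \<in> \<Phi> \<Longrightarrow> \<beta> \<in> \<Phi> \<Longrightarrow> pairing \<alpha> \<beta> \<in> \<int>"
  using crystallographic by (auto simp: crystallographic_def pairing_def)

lemma simple_roots: "\<Delta> \<subseteq> \<Phi>" and independent: "independent \<Delta>"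
  using simple_system by (auto simp: simple_system_def)

lemma finite_simple: "finite \<Delta>"
  using simple_roots finite_roots finite_subset by blast

lemma span_simple: "span \<Delta> = UNIV"
proof -
  have "\<beta> \<in> span \<Delta>" if nonneg: "\<beta> \<in> nonneg_combinations \<Delta>" for \<beta>
  proof -
    obtain c :: "'a \<Rightarrow> nat" where "\<beta> = (\<Sum>\<alpha>\<in>\<Delta>. real (c \<alpha>) *\<^sub>R \<alpha>)"
      using nonneg by (auto simp: nonneg_combinations_def)
    then show ?thesis by (simp add: span_sum span_scale span_base)
  qed
  then have "\<beta> \<in> span \<Delta>" if "\<beta> \<in> \<Phi>" for \<beta>
    using simple_system that span_neg[of "- \<beta>" \<Delta>] by (auto simp: simple_system_def)
  then have "\<Phi> \<subseteq> span \<Delta>" by blast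
  then have "span \<Phi> \<subseteq> span \<Delta>" by (simp add: span_minimal)
  then show ?thesis using root_system by (auto simp: root_system_def)
qed

lemma coef_linear:
  "coef \<delta> (u + v) = coef \<delta> u + coef \<delta> v"
  "coef \<delta> (u - v) = coef \<delta> u - coef \<delta> v"
  "coef \<delta> (- u) = - coef \<delta> u"
  "coef \<delta> (c *\<^sub>R u) = c * coef \<delta> u"
  "coef \<delta> 0 = 0"
  by (simp_all add: representation_add representation_diff representation_neg representation_scale
      representation_zero independent span_simple)

lemma coef_simple: "\<epsilon> \<in> \<Delta> \<Longrightarrow> coef \<delta> \<epsilon> = (if \<delta> = \<epsilon> then 1 else 0)"
  by (simp add: representation_basis independent)

lemma sum_coef: "(\<Sum>\<delta>\<in>\<Delta>. coef \<delta> v *\<^sub>R \<delta>) = v"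
  by (rule sum_representation_eq) (auto simp: independent span_simple finite_simple)

lemma coef_eq_zero: "(\<And>\<delta>. \<delta> \<in> \<Delta> \<Longrightarrow> coef \<delta> v = 0) \<Longrightarrow> v = 0"
  using sum_coef[of v] by simp

lemma coef_nonneg_combination:
  assumes "v \<in> nonneg_combinations \<Delta>" "\<delta> \<in> \<Delta>"
  shows "0 \<le> coef \<delta> v" "coef \<delta> v \<in> \<int>"
proof -
  obtain c :: "'a \<Rightarrow> nat" where v: "v = (\<Sum>\<alpha>\<in>\<Delta>. real (c \<alpha>) *\<^sub>R \<alpha>)"
    using assms(1) by (auto simp: nonneg_combinations_def)
  have "coef \<delta> v = (\<Sum>\<alpha>\<in>\<Delta>. coef \<delta> (real (c \<alpha>) *\<^sub>R \<alpha>))"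
    by (simp add: v representation_sum independent span_simple)
  also have "\<dots> = (\<Sum>\<alpha>\<in>\<Delta>. if \<delta> = \<alpha> then real (c \<alpha>) else 0)"
    by (intro sum.cong) (auto simp: coef_linear coef_simple)
  also have "\<dots> = real (c \<delta>)" using assms(2) finite_simple by simp
  finally show "0 \<le> coef \<delta> v" "coef \<delta> v \<in> \<int>" by simp_all
qed

lemma root_sign: "\<beta> \<in> \<Phi> \<Longrightarrow> \<beta> \<in> pos_roots \<or> - \<beta> \<in> pos_roots"
  using simple_system coef_nonneg_combination uminus_root[of \<beta>]
  unfolding simple_system_def pos_roots_def by blast

lemma coef_root_Ints:
  assumes "\<beta> \<in> \<Phi>" "\<delta> \<in> \<Delta>" shows "coef \<delta> \<beta> \<in> \<int>"
proof -
  have "\<beta> \<in> nonneg_combinations \<Delta> \<or> - \<beta> \<in> nonneg_combinations \<Delta>"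
    using assms simple_system by (auto simp: simple_system_def)
  then show ?thesis
    using coef_nonneg_combination(2)[OF _ assms(2)] by (metis coef_linear(3) minus_in_Ints_iff)
qed

lemma pos_roots_disjoint: "\<beta> \<in> pos_roots \<Longrightarrow> - \<beta> \<notin> pos_roots"
proof
  assume "\<beta> \<in> pos_roots" "- \<beta> \<in> pos_roots"
  then have "coef \<delta> \<beta> = 0" if "\<delta> \<in> \<Delta>" for \<delta>
    using that by (force simp: pos_roots_def coef_linear intro: antisym)
  then have "\<beta> = 0" by (rule coef_eq_zero)
  then show False using \<open>\<beta> \<in> pos_roots\<close> zero_notin_roots by (auto simp: pos_roots_def)
qed

lemma highest: "\<theta> \<in> \<Phi>" "\<beta> \<in> \<Phi> \<Longrightarrow> \<delta> \<in> \<Delta> \<Longrightarrow> coef \<delta> \<beta> \<le> coef \<delta> \<theta>"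
proof -
  show "\<theta> \<in> \<Phi>" using highest_root by (simp add: highest_root_def)
  assume "\<beta> \<in> \<Phi>" "\<delta> \<in> \<Delta>"
  then have "0 \<le> coef \<delta> (\<theta> - \<beta>)"
    using highest_root by (intro coef_nonneg_combination) (auto simp: highest_root_def)
  then show "coef \<delta> \<beta> \<le> coef \<delta> \<theta>" by (simp add: coef_linear)
qed

text \<open>Compare \<theta> with the root - \<theta>.\<close>

lemma coef_highest_nonneg: "\<delta> \<in> \<Delta> \<Longrightarrow> 0 \<le> coef \<delta> \<theta>"
  using highest(2)[OF uminus_root[OF highest(1)]] by (force simp: coef_linear)

section \<open>Affine roots and their signs\<close>

lemma affine_coef_linear:
  "affine_coef \<delta> (a + b) = affine_coef \<delta> a + affine_coef \<delta> b"
  "affine_coef \<delta> (a - b) = affine_coef \<delta> a - affine_coef \<delta> b"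
  "affine_coef \<delta> (- a) = - affine_coef \<delta> a"
  "affine_coef \<delta> (c *\<^sub>R a) = c * affine_coef \<delta> a"
  by (simp_all add: affine_coef_def coef_linear algebra_simps)

lemma affine_coef_eqI:
  assumes "snd a = snd b" "\<And>\<delta>. \<delta> \<in> \<Delta> \<Longrightarrow> affine_coef \<delta> a = affine_coef \<delta> b"
  shows "a = b"
proof -
  have "fst a - fst b = 0"
    using assms by (intro coef_eq_zero) (auto simp: affine_coef_def coef_linear)
  with assms(1) show ?thesis by (simp add: prod_eq_iff)
qed

lemma fst_affine_root: "b \<in> affine_roots \<Longrightarrow> fst b \<in> \<Phi>" "b \<in> affine_roots \<Longrightarrow> fst b \<noteq> 0"
  using zero_notin_roots by (auto simp: affine_roots_def)

lemma uminus_affine_root: "b \<in> affine_roots \<Longrightarrow> - b \<in> affine_roots"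
  by (auto simp: affine_roots_def uminus_root)

lemma act_affine_root: "a \<in> affine_roots \<Longrightarrow> b \<in> affine_roots \<Longrightarrow> act a b \<in> affine_roots"
  by (auto simp: affine_roots_def act_def reflect_root pairing_Ints)

lemma foldr_act_affine_root:
  "set as \<subseteq> affine_roots \<Longrightarrow> b \<in> affine_roots \<Longrightarrow> foldr act as b \<in> affine_roots"
  by (induction as) (auto simp: act_affine_root)

lemma fold_act_affine_root:
  "set as \<subseteq> affine_roots \<Longrightarrow> b \<in> affine_roots \<Longrightarrow> fold act as b \<in> affine_roots"
  by (induction as arbitrary: b) (auto simp: act_affine_root)

lemma pos_affine_root: "b \<in> pos_affine \<Longrightarrow> b \<in> affine_roots"
  by (simp add: pos_affine_def)

text \<open>\<theta> dominates the root - \<open>fst b\<close> coefficientwise, so adding one copy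
  of \<theta> to \<open>fst b\<close> already makes all coefficients nonnegative; further copies
  only help.\<close>

lemma pos_affineI:
  assumes "b \<in> affine_roots" "1 \<le> snd b" shows "b \<in> pos_affine"
proof -
  have "0 \<le> affine_coef \<delta> b" if "\<delta> \<in> \<Delta>" for \<delta>
  proof -
    have "0 \<le> coef \<delta> (fst b) + coef \<delta> \<theta>"
      using highest(2)[of "- fst b" \<delta>] that assms(1) by (auto simp: fst_affine_root uminus_root coef_linear)
    also have "\<dots> \<le> coef \<delta> (fst b) + snd b * coef \<delta> \<theta>"
      using assms(2) coef_highest_nonneg[OF that] by (simp add: mult_le_cancel_right1)
    finally show ?thesis by (simp add: affine_coef_def coef_linear)
  qed
  with assms show ?thesis by (simp add: pos_affine_def)
qed

text \<open>Links the two views of positivity: coefficients suit the simple reflections, levels suit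
  the counting of inversions.\<close>

lemma pos_affine_iff:
  assumes "b \<in> affine_roots"
  shows "b \<in> pos_affine \<longleftrightarrow> 0 < snd b \<or> snd b = 0 \<and> fst b \<in> pos_roots"
proof -
  obtain k :: int where k: "snd b = of_int k"
    using assms by (auto simp: affine_roots_def elim: Ints_cases)
  consider "k \<ge> 1" | "k = 0" | "k < 0" by linarith
  then show ?thesis
  proof cases
    case 1
    then show ?thesis using pos_affineI[OF assms] k by auto
  next
    case 2
    then show ?thesis using assms k
      by (auto simp: pos_affine_def pos_roots_def affine_coef_def fst_affine_root)
  next
    case 3
    then show ?thesis using k by (auto simp: pos_affine_def)
  qed
qed

lemma affine_root_sign: "b \<in> affine_roots \<Longrightarrow> b \<in> pos_affine \<or> - b \<in> pos_affine"
  using root_sign[of "fst b"] by (auto simp: pos_affine_iff uminus_affine_root fst_affine_root)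

lemma pos_affine_disjoint: "b \<in> pos_affine \<Longrightarrow> - b \<notin> pos_affine"
  using pos_roots_disjoint[of "fst b"] pos_affine_root[of b] by (auto simp: pos_affine_iff uminus_affine_root)

text \<open>Reducedness leaves the factors 1 and -1, and positivity excludes the latter.\<close>

lemma proportional_pos_affine:
  assumes "a \<in> pos_affine" "b \<in> pos_affine" "b = c *\<^sub>R a"
  shows "b = a"
proof -
  have "c = 1 \<or> c = -1"
    using assms by (intro reduced_root[of "fst a"]) (auto dest!: pos_affine_root fst_affine_root(1))
  then show ?thesis
  proof
    assume "c = -1"
    then have "b = - a" using assms(3) by simp
    then show ?thesis using assms pos_affine_disjoint by blast
  qed (use assms(3) in simp)
qed

lemma act_eq_uminus_iff:
  assumes "a \<in> pos_affine" "b \<in> pos_affine"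
  shows "act a b = - b \<longleftrightarrow> b = a"
proof
  assume "act a b = - b"
  then have "2 *\<^sub>R b = pairing (fst a) (fst b) *\<^sub>R a" by (simp add: act_def scaleR_2 algebra_simps)
  then have "(1/2) *\<^sub>R (2 *\<^sub>R b) = (1/2) *\<^sub>R (pairing (fst a) (fst b) *\<^sub>R a)" by simp
  then have "b = (pairing (fst a) (fst b) / 2) *\<^sub>R a" by simp
  then show "b = a" using assms proportional_pos_affine by blast
qed (use assms in \<open>simp add: act_self fst_affine_root pos_affine_root\<close>)

text \<open>A reflection determines its positive root as the only positive root that it
  negates.\<close>

lemma inj_on_reflection: "inj_on reflection pos_affine"
proof (rule inj_onI)
  fix a b assume ab: "a \<in> pos_affine" "b \<in> pos_affine" "reflection a = reflection b"
  have "act b a = act a a"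
    by (rule ev_inject) (simp add: ab(3) flip: ev_reflection)
  then have "act b a = - a"
    using ab by (simp add: act_self fst_affine_root pos_affine_root)
  then show "a = b" using act_eq_uminus_iff ab by blast
qed

section \<open>Simple affine roots and descent by height\<close>

lemma simple_affine_pos: "a \<in> simple_affine \<Longrightarrow> a \<in> pos_affine"
  using simple_roots highest(1)
  by (auto simp: simple_affine_def pos_affine_def affine_roots_def uminus_root affine_coef_def coef_linear coef_simple)

lemma height_simple: "a \<in> simple_affine \<Longrightarrow> height a = 1"
  by (auto simp: simple_affine_def height_def affine_coef_def coef_linear coef_simple finite_simple)

lemma height_diff: "height (b - c *\<^sub>R a) = height b - c * height a"
  by (simp add: height_def affine_coef_linear sum_subtractf sum_distrib_left algebra_simps)

lemma height_pos_affine: "b \<in> pos_affine \<Longrightarrow> 0 \<le> height b \<and> height b \<in> \<int>"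
  unfolding height_def
proof
  assume b: "b \<in> pos_affine"
  then show "0 \<le> snd b + (\<Sum>\<delta>\<in>\<Delta>. affine_coef \<delta> b)"
    by (auto simp: pos_affine_def intro!: add_nonneg_nonneg sum_nonneg)
  show "snd b + (\<Sum>\<delta>\<in>\<Delta>. affine_coef \<delta> b) \<in> \<int>"
    using b coef_root_Ints highest(1)
    by (auto simp: pos_affine_def affine_roots_def affine_coef_def coef_linear
        intro!: Ints_add Ints_sum Ints_mult)
qed

text \<open>Acting by \<open>a\<close> changes only the coefficient at \<open>a\<close>. If the
  result were negative, all other coefficients of \<open>b\<close> would be both nonnegative and
  nonpositive, and \<open>b\<close> would be a multiple of \<open>a\<close>.\<close>

lemma act_simple_pos:
  assumes a: "a \<in> simple_affine" and b: "b \<in> pos_affine" "b \<noteq> a"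
  shows "act a b \<in> pos_affine"
proof (rule ccontr)
  assume "act a b \<notin> pos_affine"
  then have neg: "- act a b \<in> pos_affine"
    using affine_root_sign act_affine_root simple_affine_pos a b pos_affine_root by blast
  let ?n = "pairing (fst a) (fst b)"
  have snd0: "snd b \<ge> 0" "snd b - ?n * snd a \<le> 0"
    using b neg by (simp_all add: pos_affine_def act_def)
  have coef0: "affine_coef \<delta> b \<ge> 0" "affine_coef \<delta> b - ?n * affine_coef \<delta> a \<le> 0" if "\<delta> \<in> \<Delta>" for \<delta>
    using b neg that by (force simp: pos_affine_def act_def affine_coef_linear)+
  have "\<exists>c. b = c *\<^sub>R a"
  \<comment> \<open>The coefficient at this root is \<open>snd\<close>, the remaining ones are the
    \<open>affine_coef\<close>; hence two cases.\<close>
  proof (cases "a = (- \<theta>, 1)")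
    case True
    then have "snd a = 1" and a0: "affine_coef \<delta> a = 0" for \<delta>
      by (simp_all add: affine_coef_def coef_linear)
    moreover have "affine_coef \<delta> b = 0" if "\<delta> \<in> \<Delta>" for \<delta>
      using coef0[OF that] by (simp add: a0)
    ultimately have "b = snd b *\<^sub>R a"
      by (intro affine_coef_eqI) (simp_all add: affine_coef_linear)
    then show ?thesis by blast
  next
    case False
    then obtain \<delta> where \<delta>: "\<delta> \<in> \<Delta>" "a = (\<delta>, 0)" using a by (auto simp: simple_affine_def)
    then have a\<delta>: "affine_coef \<epsilon> a = (if \<epsilon> = \<delta> then 1 else 0)" for \<epsilon>
      by (simp add: affine_coef_def coef_simple)
    have "b = affine_coef \<delta> b *\<^sub>R a"
    proof (rule affine_coef_eqI)
      show "snd b = snd (affine_coef \<delta> b *\<^sub>R a)" using snd0 \<delta> by simp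
      show "affine_coef \<epsilon> b = affine_coef \<epsilon> (affine_coef \<delta> b *\<^sub>R a)" if "\<epsilon> \<in> \<Delta>" for \<epsilon>
        using coef0[OF that] by (cases "\<epsilon> = \<delta>") (simp_all add: affine_coef_linear a\<delta>)
    qed
    then show ?thesis by blast
  qed
  then show False using proportional_pos_affine simple_affine_pos a b by blast
qed

text \<open>The gradient of a positive root is a nonnegative combination of the simple gradients. If
  it had nonpositive inner product with all of them, its squared norm would be at most 0.\<close>

lemma exists_simple_pairing_pos:
  assumes "b \<in> pos_affine"
  shows "\<exists>a\<in>simple_affine. 0 < pairing (fst a) (fst b)"
proof (rule ccontr)
  assume *: "\<not> ?thesis"
  have le0: "fst b \<bullet> fst a \<le> 0" if "a \<in> simple_affine" for a
  proof -
    have "0 < fst a \<bullet> fst a"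
      using that simple_affine_pos pos_affine_root fst_affine_root(2) by auto
    then show ?thesis using * that by (force simp: pairing_def zero_less_divide_iff not_less)
  qed
  have "fst b = snd b *\<^sub>R (- \<theta>) + (\<Sum>\<delta>\<in>\<Delta>. affine_coef \<delta> b *\<^sub>R \<delta>)"
    by (simp add: affine_coef_def sum_coef)
  then have "fst b \<bullet> fst b = fst b \<bullet> (snd b *\<^sub>R (- \<theta>) + (\<Sum>\<delta>\<in>\<Delta>. affine_coef \<delta> b *\<^sub>R \<delta>))" by simp
  also have "\<dots> = snd b * (fst b \<bullet> (- \<theta>)) + (\<Sum>\<delta>\<in>\<Delta>. affine_coef \<delta> b * (fst b \<bullet> \<delta>))"
    by (simp add: inner_simps inner_sum_right)
  also have "\<dots> \<le> 0"
    using assms le0[of "(- \<theta>, 1)"] le0[of "(\<delta>, 0)" for \<delta>]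
    by (intro add_nonpos_nonpos sum_nonpos mult_nonneg_nonpos) (auto simp: pos_affine_def simple_affine_def)
  finally show False using assms pos_affine_root fst_affine_root(2) by (simp add: inner_gt_zero_iff flip: not_less)
qed

text \<open>Descent on the height: reflecting in a simple root with positive pairing subtracts a
  positive integer from the height and keeps the root positive, unless the root is that simple root
  itself.\<close>

lemma reflection_conjugate_simple:
  assumes "b \<in> pos_affine"
  shows "\<exists>as a. set as \<subseteq> simple_affine \<and> a \<in> simple_affine \<and> reflection b = word as \<circ> reflection a \<circ> word (rev as)"
  using assms
proof (induction "nat \<lfloor>height b\<rfloor>" arbitrary: b rule: less_induct)
  case less
  obtain c where c: "c \<in> simple_affine" "0 < pairing (fst c) (fst b)"
    using exists_simple_pairing_pos less.prems by blast
  show ?case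
  proof (cases "b = c")
    case True
    then show ?thesis using c by (intro exI[of _ "[]"] exI[of _ c]) auto
  next
    case False
    have c0: "fst c \<noteq> 0" and cR: "c \<in> affine_roots"
      using c simple_affine_pos pos_affine_root fst_affine_root by blast+
    have pos: "act c b \<in> pos_affine" using act_simple_pos c less.prems False by blast
    have "pairing (fst c) (fst b) \<in> \<int>"
      using pairing_Ints fst_affine_root(1) cR less.prems pos_affine_root by blast
    then have "height (act c b) \<le> height b - 1"
      using c by (auto simp: act_def height_diff height_simple elim!: Ints_cases)
    then have "nat \<lfloor>height (act c b)\<rfloor> < nat \<lfloor>height b\<rfloor>"
      using height_pos_affine[OF pos] by linarith
    then obtain as a where as: "set as \<subseteq> simple_affine" "a \<in> simple_affine"
        "reflection (act c b) = word as \<circ> reflection a \<circ> word (rev as)"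
      using less.hyps pos by blast
    have "reflection b = reflection c \<circ> reflection (act c b) \<circ> reflection c"
      using reflection_act[OF c0, of "act c b"] act_act[OF c0] by simp
    then have "reflection b = word (c # as) \<circ> reflection a \<circ> word (rev (c # as))"
      by (simp add: as(3) word_append fun_eq_iff)
    then show ?thesis using as c by (intro exI[of _ "c # as"] exI[of _ a]) auto
  qed
qed

section \<open>Inversions and shortest words\<close>

definition inversions :: "('a \<times> real) list \<Rightarrow> ('a \<times> real) set" where
  "inversions as = {b \<in> pos_affine. - fold act as b \<in> pos_affine}"

text \<open>The strong exchange condition. Following \<open>b\<close> through the word, some letter
  turns it negative; by \<open>act_simple_pos\<close> it must then have become that letter itself,
  and multiplication by \<open>reflection b\<close> deletes this letter.\<close>

lemma exchange:
  assumes "set as \<subseteq> simple_affine" "b \<in> inversions as"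
  shows "\<exists>bs. set bs \<subseteq> simple_affine \<and> length bs < length as \<and> reflection b \<circ> word as = word bs"
  using assms
proof (induction as arbitrary: b)
  case Nil
  then show ?case using pos_affine_disjoint[of b] by (simp add: inversions_def)
next
  case (Cons c as)
  have c: "c \<in> simple_affine" "fst c \<noteq> 0"
    using Cons.prems simple_affine_pos pos_affine_root fst_affine_root(2) by auto
  show ?case
  proof (cases "b = c")
    case True
    then show ?thesis using Cons.prems c by (intro exI[of _ as]) (auto simp: fun_eq_iff reflection_reflection)
  next
    case False
    then have "act c b \<in> inversions as"
      using Cons.prems c act_simple_pos by (simp add: inversions_def)
    moreover have "set as \<subseteq> simple_affine" using Cons.prems(1) by simp
    ultimately obtain bs where bs: "set bs \<subseteq> simple_affine" "length bs < length as"
        "reflection (act c b) \<circ> word as = word bs"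
      using Cons.IH[of "act c b"] by blast
    have eq: "reflection b \<circ> word (c # as) = word (c # bs)"
    proof
      fix x
      show "(reflection b \<circ> word (c # as)) x = word (c # bs) x"
        using c(2) fun_cong[OF bs(3), of x, symmetric] by (simp add: reflection_act reflection_reflection)
    qed
    show ?thesis
      by (intro exI[of _ "c # bs"] conjI eq) (use bs c in simp_all)
  qed
qed

text \<open>Stated as a dichotomy, so that the induction does not have to know that tails of
  shortest words are shortest. A new first letter either is an inversion of the tail, and exchange
  shortens the word, or it adds exactly one inversion.\<close>

lemma card_inversions:
  assumes "set as \<subseteq> simple_affine"
  shows "finite (inversions as) \<and> card (inversions as) = length as \<or>
    (\<exists>bs. set bs \<subseteq> simple_affine \<and> length bs < length as \<and> word bs = word as)"
  using assms
proof (induction as)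
  case Nil
  have "inversions [] = {}" using pos_affine_disjoint by (auto simp: inversions_def)
  then show ?case by simp
next
  case (Cons a as)
  have a: "a \<in> simple_affine" "a \<in> pos_affine" "fst a \<noteq> 0"
    using Cons.prems simple_affine_pos pos_affine_root fst_affine_root(2) by auto
  from Cons consider (reduced) "finite (inversions as)" "card (inversions as) = length as"
    | (short) bs where "set bs \<subseteq> simple_affine" "length bs < length as" "word bs = word as"
    by auto
  then show ?case
  proof cases
    case short
    then have eq: "word (a # bs) = word (a # as)" by (simp only: word_Cons)
    show ?thesis
      by (intro disjI2 exI[of _ "a # bs"] conjI eq) (use short a in simp_all)
  next
    case reduced
    show ?thesis
    proof (cases "a \<in> inversions as")
      case True
      moreover have "set as \<subseteq> simple_affine" using Cons.prems by simp
      ultimately obtain bs where bs: "set bs \<subseteq> simple_affine" "length bs < length as"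
          "reflection a \<circ> word as = word bs"
        using exchange[of as a] by blast
      then have eq: "word bs = word (a # as)" by (simp only: word_Cons)
      show ?thesis
        by (intro disjI2 exI[of _ bs] conjI eq) (use bs in simp_all)
    next
      case False
      have pos: "fold act as a \<in> pos_affine"
      proof -
        have "set as \<subseteq> affine_roots"
          using Cons.prems simple_affine_pos pos_affine_root by (meson set_subset_Cons subset_iff)
        then have "fold act as a \<in> affine_roots"
          using a pos_affine_root by (intro fold_act_affine_root)
        then show ?thesis using False a(2) affine_root_sign[of "fold act as a"] by (simp add: inversions_def)
      qed
      \<comment> \<open>\<open>act a\<close> permutes the positive roots other than
        \<open>a\<close>; the root \<open>a\<close> is negated by the first letter and then stays
        negative, because the tail keeps it positive.\<close>
      have "inversions (a # as) = insert a (act a ` inversions as)"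
      proof (intro equalityI subsetI)
        fix b assume b: "b \<in> inversions (a # as)"
        show "b \<in> insert a (act a ` inversions as)"
        proof (cases "b = a")
          case False
          then have "act a b \<in> inversions as"
            using b a(1) act_simple_pos[of a b] by (simp add: inversions_def)
          then have "act a (act a b) \<in> act a ` inversions as" by (rule imageI)
          then show ?thesis by (simp add: act_act[OF a(3)])
        qed simp
      next
        fix b assume "b \<in> insert a (act a ` inversions as)"
        then show "b \<in> inversions (a # as)"
        proof
          assume "b = a"
          then show ?thesis using a(2,3) pos by (simp add: inversions_def act_self fold_act_uminus)
        next
          assume "b \<in> act a ` inversions as"
          then obtain d where d: "d \<in> inversions as" "b = act a d" by blast
          with False have "d \<noteq> a" by blast
          with d show ?thesis
            using a(1,3) act_simple_pos[of a d] by (simp add: inversions_def act_act)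
        qed
      qed
      moreover have "a \<notin> act a ` inversions as"
      proof
        assume "a \<in> act a ` inversions as"
        then obtain d where "d \<in> inversions as" "a = act a d" by blast
        then have "d = - a" using act_act[OF a(3), of d] act_self[OF a(3)] by simp
        then show False using \<open>d \<in> inversions as\<close> a(2) pos_affine_disjoint[of a] by (simp add: inversions_def)
      qed
      moreover have "inj_on (act a) (inversions as)"
        by (rule inj_on_inverseI[of _ "act a"]) (rule act_act[OF a(3)])
      ultimately show ?thesis using reduced by (simp add: card_image)
    qed
  qed
qed

section \<open>The affine Weyl group\<close>

abbreviation "weyl \<equiv> affine_weyl_group \<Phi>"
abbreviation "gens \<equiv> simple_affine_reflections \<Delta> \<theta>"

lemma gens_eq: "gens = reflection ` simple_affine"
proof -
  have "reflection (- \<theta>, 1) = affine_reflection \<theta> 1"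
    using reflection_uminus[of "(- \<theta>, 1)"] by (simp add: reflection_def)
  then show ?thesis
    by (simp add: simple_affine_reflections_def simple_affine_def image_image reflection_def)
qed

lemma bij_reflection_root: "a \<in> affine_roots \<Longrightarrow> bij (reflection a)"
  by (simp add: bij_reflection fst_affine_root)

lemma bij_word: "set as \<subseteq> affine_roots \<Longrightarrow> bij (word as)"
  by (induction as) (auto simp: bij_comp bij_reflection_root)

lemma simple_affine_root: "simple_affine \<subseteq> affine_roots"
  using simple_affine_pos pos_affine_root by blast

lemma weyl_simps:
  "mult weyl = mult (BijGroup UNIV)" "one weyl = id"
  "carrier weyl = generate (BijGroup UNIV) (reflection ` affine_roots)"
proof -
  have "{affine_reflection \<alpha> (real_of_int k) | \<alpha> k. \<alpha> \<in> \<Phi>} = reflection ` affine_roots"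
  proof (intro equalityI subsetI)
    fix r assume "r \<in> {affine_reflection \<alpha> (real_of_int k) | \<alpha> k. \<alpha> \<in> \<Phi>}"
    then obtain \<alpha> k where "\<alpha> \<in> \<Phi>" "r = affine_reflection \<alpha> (real_of_int k)" by blast
    then have "r = reflection (\<alpha>, of_int (- k))" "(\<alpha>, of_int (- k)) \<in> affine_roots"
      by (auto simp: reflection_def affine_roots_def)
    then show "r \<in> reflection ` affine_roots" by blast
  next
    fix r assume "r \<in> reflection ` affine_roots"
    then obtain \<alpha> k where "\<alpha> \<in> \<Phi>" "r = reflection (\<alpha>, of_int k)"
      by (auto simp: affine_roots_def elim!: Ints_cases)
    then have "r = affine_reflection \<alpha> (of_int (- k))" "\<alpha> \<in> \<Phi>" by (auto simp: reflection_def)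
    then show "r \<in> {affine_reflection \<alpha> (real_of_int k) | \<alpha> k. \<alpha> \<in> \<Phi>}" by blast
  qed
  then show "carrier weyl = generate (BijGroup UNIV) (reflection ` affine_roots)"
    by (simp add: affine_weyl_group_def)
qed (simp_all add: affine_weyl_group_def one_BijGroup)

lemma foldr_weyl: "set as \<subseteq> affine_roots \<Longrightarrow> foldr (mult weyl) (map reflection as) (one weyl) = word as"
  unfolding weyl_simps word_conv_foldr
  by (rule foldr_mult_BijGroup[THEN conjunct1]) (auto simp: bij_reflection_root)

lemma coxeter_length_eq:
  "coxeter_length weyl gens w = (LEAST n. \<exists>as. length as = n \<and> set as \<subseteq> simple_affine \<and> word as = w)"
  unfolding coxeter_length_def
proof (intro arg_cong[where f = Least] ext iffI)
  fix n assume "\<exists>ss. length ss = n \<and> set ss \<subseteq> gens \<and> foldr (mult weyl) ss (one weyl) = w"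
  then obtain ss where ss: "length ss = n" "set ss \<subseteq> gens" "foldr (mult weyl) ss (one weyl) = w" by blast
  then have "ss \<in> lists (reflection ` simple_affine)" by (auto simp: gens_eq)
  then obtain as where as: "as \<in> lists simple_affine" "ss = map reflection as"
    unfolding lists_image by blast
  then have sub: "set as \<subseteq> simple_affine" by auto
  with ss(3) have "word as = w"
    unfolding as(2) using foldr_weyl[of as] simple_affine_root by simp
  then show "\<exists>as. length as = n \<and> set as \<subseteq> simple_affine \<and> word as = w"
    using ss(1) sub as(2) by (intro exI[of _ as]) simp
next
  fix n assume "\<exists>as. length as = n \<and> set as \<subseteq> simple_affine \<and> word as = w"
  then obtain as where as: "length as = n" "set as \<subseteq> simple_affine" "word as = w" by blast
  then show "\<exists>ss. length ss = n \<and> set ss \<subseteq> gens \<and> foldr (mult weyl) ss (one weyl) = w"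
    using foldr_weyl[of as] simple_affine_root
    by (intro exI[of _ "map reflection as"]) (auto simp: gens_eq)
qed

text \<open>Conjugacy to a simple reflection provides some word, so the minimum is attained; a
  minimal word cannot be shortened, so its length counts its inversions. These are also the
  inversions of \<open>[b]\<close>, a word for the same element with one letter that need not be
  simple.\<close>

lemma coxeter_length_reflection:
  assumes "b \<in> pos_affine"
  shows "coxeter_length weyl gens (reflection b) = card (inversions [b])"
proof -
  let ?P = "\<lambda>n. \<exists>as. length as = n \<and> set as \<subseteq> simple_affine \<and> word as = reflection b"
  obtain as a where "set as \<subseteq> simple_affine" "a \<in> simple_affine"
      "reflection b = word as \<circ> reflection a \<circ> word (rev as)"
    using reflection_conjugate_simple[OF assms] by blast
  then have "?P (length (as @ a # rev as))"
    by (intro exI[of _ "as @ a # rev as"]) (auto simp: word_append comp_assoc)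
  then have "?P (LEAST n. ?P n)" by (rule LeastI)
  then obtain bs where bs: "length bs = (LEAST n. ?P n)" "set bs \<subseteq> simple_affine" "word bs = reflection b"
    by blast
  have "\<not> length cs < length bs" if "set cs \<subseteq> simple_affine" "word cs = word bs" for cs
  proof
    assume "length cs < length bs"
    then have "\<not> ?P (length cs)" unfolding bs(1) by (rule not_less_Least)
    moreover have "word cs = reflection b" using that(2) bs(3) by (rule trans)
    ultimately show False using that(1) by blast
  qed
  then have "card (inversions bs) = length bs"
    using card_inversions[OF bs(2)] by blast
  moreover have "inversions bs = inversions [b]"
  proof -
    have "fold act bs c = fold act [b] c" for c
      by (rule fold_act_eq_of_word_eq) (simp add: bs(3))
    then show ?thesis unfolding inversions_def by (simp only:)
  qed
  ultimately show ?thesis by (simp only: coxeter_length_eq bs(1))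
qed

section \<open>The reflections of the Coxeter system as affine reflections\<close>

lemma inv_word:
  assumes "set as \<subseteq> affine_roots"
  shows "inv\<^bsub>BijGroup UNIV\<^esub> (word as) = word (rev as)"
proof -
  interpret group "BijGroup (UNIV :: 'a set)" by (rule group_BijGroup)
  have "bij (word as)" "bij (word (rev as))" using assms by (simp_all add: bij_word)
  moreover have "word (rev as) \<circ> word as = id"
    using word_rev[of "rev as"] assms fst_affine_root(2) by auto
  ultimately show ?thesis
    by (intro inv_equality) (simp_all add: mult_BijGroup one_BijGroup, simp_all add: BijGroup_def bij_Bij)
qed

lemma carrier_weyl: "carrier weyl = {word as | as. set as \<subseteq> affine_roots}"
proof (intro equalityI subsetI)
  fix w assume "w \<in> carrier weyl"
  then have "w \<in> generate (BijGroup UNIV) (reflection ` affine_roots)" by (simp only: weyl_simps)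
  then show "w \<in> {word as | as. set as \<subseteq> affine_roots}"
  proof induction
    case one
    then show ?case by (intro CollectI exI[of _ "[]"]) (simp add: one_BijGroup)
  next
    case (incl h)
    then obtain a where "a \<in> affine_roots" "h = reflection a" by blast
    then show ?case by (intro CollectI exI[of _ "[a]"]) simp
  next
    case (inv h)
    then obtain a where a: "a \<in> affine_roots" "h = reflection a" by blast
    then have "inv\<^bsub>BijGroup UNIV\<^esub> h = word [a]" using inv_word[of "[a]"] by simp
    with a show ?case by (intro CollectI exI[of _ "[a]"]) simp
  next
    case (eng h1 h2)
    then obtain as bs where w: "h1 = word as" "set as \<subseteq> affine_roots" "h2 = word bs" "set bs \<subseteq> affine_roots"
      by blast
    then have "h1 \<otimes>\<^bsub>BijGroup UNIV\<^esub> h2 = word (as @ bs)"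
      by (simp add: mult_BijGroup bij_word word_append)
    with w show ?case by (intro CollectI exI[of _ "as @ bs"]) simp
  qed
next
  fix w assume "w \<in> {word as | as. set as \<subseteq> affine_roots}"
  then obtain as where "set as \<subseteq> affine_roots" "w = word as" by blast
  then show "w \<in> carrier weyl"
  proof (induction as arbitrary: w)
    case Nil
    have "id \<in> carrier weyl"
      using generate.one[of "BijGroup UNIV"] by (simp only: weyl_simps one_BijGroup)
    then show ?case using Nil by (simp only: word_Nil)
  next
    case (Cons a as)
    then have "reflection a \<otimes>\<^bsub>BijGroup UNIV\<^esub> word as \<in> carrier weyl"
      by (auto simp: weyl_simps intro: generate.eng generate.incl)
    moreover have "reflection a \<otimes>\<^bsub>BijGroup UNIV\<^esub> word as = reflection a \<circ> word as"
      using Cons.prems(1) by (intro mult_BijGroup bij_word bij_reflection_root) auto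
    ultimately show ?case unfolding Cons.prems(2) word_Cons by (simp only:)
  qed
qed

text \<open>The inverse in \<open>weyl\<close> is taken within a smaller carrier; it agrees with the
  inverse among all bijections, where a word is inverted by reversing it.\<close>

lemma weyl_conjugate:
  assumes "set as \<subseteq> affine_roots" "a \<in> affine_roots"
  shows "word as \<otimes>\<^bsub>weyl\<^esub> reflection a \<otimes>\<^bsub>weyl\<^esub> inv\<^bsub>weyl\<^esub> (word as)
    = word as \<circ> reflection a \<circ> word (rev as)"
proof -
  interpret group "BijGroup (UNIV :: 'a set)" by (rule group_BijGroup)
  have sub: "subgroup (carrier weyl) (BijGroup UNIV)"
    unfolding weyl_simps by (rule generate_is_subgroup) (auto simp: BijGroup_def bij_Bij bij_reflection_root)
  have "weyl = BijGroup UNIV\<lparr>carrier := carrier weyl\<rparr>" by (simp add: affine_weyl_group_def)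
  then have "inv\<^bsub>weyl\<^esub> (word as) = inv\<^bsub>BijGroup UNIV\<^esub> (word as)"
    using m_inv_consistent[OF sub, of "word as"] assms(1) carrier_weyl by auto
  then have "inv\<^bsub>weyl\<^esub> (word as) = word (rev as)" by (simp add: inv_word assms(1))
  then show ?thesis
    using assms by (simp add: weyl_simps mult_BijGroup bij_word bij_reflection_root bij_comp)
qed

text \<open>Conjugates of simple reflections are reflections in affine roots, and a root may be
  replaced by its negative; the converse is the descent by height.\<close>

lemma coxeter_reflections_eq: "coxeter_reflections weyl gens = reflection ` pos_affine"
proof (intro equalityI subsetI)
  fix t assume "t \<in> coxeter_reflections weyl gens"
  then obtain as a where as: "set as \<subseteq> affine_roots" "a \<in> simple_affine"
      "t = word as \<otimes>\<^bsub>weyl\<^esub> reflection a \<otimes>\<^bsub>weyl\<^esub> inv\<^bsub>weyl\<^esub> (word as)"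
    unfolding coxeter_reflections_def carrier_weyl gens_eq by blast
  have a: "a \<in> affine_roots" using as simple_affine_root by blast
  have "t = reflection (foldr act as a)"
    unfolding as(3) weyl_conjugate[OF as(1) a] using as(1) fst_affine_root(2) by (intro word_conjugate) auto
  moreover have "foldr act as a \<in> affine_roots" using foldr_act_affine_root as a by blast
  ultimately show "t \<in> reflection ` pos_affine"
    using affine_root_sign reflection_uminus by (metis image_eqI)
next
  fix t assume "t \<in> reflection ` pos_affine"
  then obtain as a where as: "set as \<subseteq> simple_affine" "a \<in> simple_affine"
      "t = word as \<circ> reflection a \<circ> word (rev as)"
    using reflection_conjugate_simple by blast
  then have R: "set as \<subseteq> affine_roots" "a \<in> affine_roots" using simple_affine_root by auto
  then have "t = word as \<otimes>\<^bsub>weyl\<^esub> reflection a \<otimes>\<^bsub>weyl\<^esub> inv\<^bsub>weyl\<^esub> (word as)"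
    using as(3) by (simp only: weyl_conjugate)
  then show "t \<in> coxeter_reflections weyl gens"
    unfolding coxeter_reflections_def carrier_weyl gens_eq using R(1) as(2) by blast
qed

section \<open>Lengths of reflections\<close>

definition int_pairing :: "'a \<Rightarrow> 'a \<Rightarrow> int" where
  "int_pairing \<alpha> \<beta> = \<lfloor>pairing \<alpha> \<beta>\<rfloor>"

text \<open>The number N: the growth of the length from one level to the next.\<close>

definition slope :: "'a \<Rightarrow> int" where
  "slope \<alpha> = (\<Sum>\<beta>\<in>pos_roots. \<bar>int_pairing \<alpha> \<beta>\<bar>)"

text \<open>The number L, which is the length of the reflection within the finite Weyl
  group.\<close>

definition offset :: "'a \<Rightarrow> int" where
  "offset \<alpha> = int (card {\<beta> \<in> pos_roots. \<beta> - pairing \<alpha> \<beta> *\<^sub>R \<alpha> \<notin> pos_roots})"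

lemma of_int_int_pairing: "\<alpha> \<in> \<Phi> \<Longrightarrow> \<beta> \<in> \<Phi> \<Longrightarrow> of_int (int_pairing \<alpha> \<beta>) = pairing \<alpha> \<beta>"
  using pairing_Ints[of \<alpha> \<beta>] by (auto simp: int_pairing_def elim: Ints_cases)

lemma pos_roots_subset: "pos_roots \<subseteq> \<Phi>" and finite_pos_roots: "finite pos_roots"
  using finite_roots by (auto simp: pos_roots_def)

lemma sum_roots: "(\<Sum>\<beta>\<in>\<Phi>. f \<beta>) = (\<Sum>\<beta>\<in>pos_roots. f \<beta> + f (- \<beta>))"
proof -
  have "(\<Sum>\<beta>\<in>\<Phi>. f \<beta>) = (\<Sum>\<beta>\<in>pos_roots \<union> uminus ` pos_roots. f \<beta>)"
    using root_sign pos_roots_subset uminus_root by (intro sum.cong refl) (fastforce simp: image_iff)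
  also have "\<dots> = (\<Sum>\<beta>\<in>pos_roots. f \<beta>) + (\<Sum>\<beta>\<in>uminus ` pos_roots. f \<beta>)"
    using finite_pos_roots pos_roots_disjoint by (intro sum.union_disjoint) auto
  also have "\<dots> = (\<Sum>\<beta>\<in>pos_roots. f \<beta> + f (- \<beta>))"
    by (simp add: sum.reindex sum.distrib)
  finally show ?thesis .
qed

lemma pairing_uminus: "pairing \<alpha> (- \<beta>) = - pairing \<alpha> \<beta>" "pairing (- \<alpha>) \<beta> = - pairing \<alpha> \<beta>"
  by (simp_all add: pairing_def)

lemma int_pairing_uminus:
  assumes "\<alpha> \<in> \<Phi>" "\<beta> \<in> \<Phi>"
  shows "int_pairing \<alpha> (- \<beta>) = - int_pairing \<alpha> \<beta>" "int_pairing (- \<alpha>) \<beta> = - int_pairing \<alpha> \<beta>"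
  using pairing_Ints[OF assms] by (auto simp: int_pairing_def pairing_uminus elim!: Ints_cases)

lemma inversions_reflection:
  assumes "\<alpha> \<in> \<Phi>"
  shows "finite (inversions [(\<alpha>, of_int k)])" (is ?fin)
    and "int (card (inversions [(\<alpha>, of_int k)])) =
      (\<Sum>\<beta>\<in>pos_roots. if \<beta> - pairing \<alpha> \<beta> *\<^sub>R \<alpha> \<in> pos_roots
        then \<bar>int_pairing \<alpha> \<beta> * k\<bar> else \<bar>int_pairing \<alpha> \<beta> * k + 1\<bar>)" (is ?card)
proof -
  define s where "s \<beta> = \<beta> - pairing \<alpha> \<beta> *\<^sub>R \<alpha>" for \<beta>
  \<comment> \<open>For fixed \<beta> the inverted (\<beta>, j) form an interval of levels. Level 0
    counts as positive for positive \<beta> only, which gives \<open>lo\<close>; the image has level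
    j - <\<beta>, \<alpha>^v> k, and image level 0 counts as negative only if
    \<open>s \<beta>\<close> is not positive, which gives \<open>hi\<close>.\<close>
  define lo :: "'a \<Rightarrow> int" where "lo \<beta> = (if \<beta> \<in> pos_roots then 0 else 1)" for \<beta>
  define hi :: "'a \<Rightarrow> int" where
    "hi \<beta> = int_pairing \<alpha> \<beta> * k - (if s \<beta> \<in> pos_roots then 1 else 0)" for \<beta>
  have s: "s \<beta> \<in> \<Phi>" "s (- \<beta>) = - s \<beta>" if "\<beta> \<in> \<Phi>" for \<beta>
    using that assms reflect_root by (auto simp: s_def pairing_uminus)
  have neg: "- \<beta> \<in> pos_roots \<longleftrightarrow> \<beta> \<notin> pos_roots" if "\<beta> \<in> \<Phi>" for \<beta>
    using that root_sign pos_roots_disjoint by blast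
  have mem: "(\<beta>, of_int j) \<in> inversions [(\<alpha>, of_int k)] \<longleftrightarrow> lo \<beta> \<le> j \<and> j \<le> hi \<beta>" if "\<beta> \<in> \<Phi>" for \<beta> j
  proof -
    have R: "(\<beta>, of_int j) \<in> affine_roots" "(\<alpha>, of_int k) \<in> affine_roots"
      using that assms by (auto simp: affine_roots_def)
    have act: "- act (\<alpha>, of_int k) (\<beta>, of_int j) = (- s \<beta>, of_int (int_pairing \<alpha> \<beta> * k - j))"
      using that assms by (simp add: act_def s_def of_int_int_pairing)
    have "(\<beta>, of_int j) \<in> pos_affine \<longleftrightarrow> lo \<beta> \<le> j"
      using R by (auto simp: pos_affine_iff lo_def)
    moreover have "- act (\<alpha>, of_int k) (\<beta>, of_int j) \<in> pos_affine \<longleftrightarrow> j \<le> hi \<beta>"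
      using uminus_affine_root[OF act_affine_root[OF R(2,1)]] neg[OF s(1)[OF that]] unfolding act
      by (auto simp: pos_affine_iff hi_def simp del: of_int_diff of_int_mult)
    ultimately show ?thesis by (simp add: inversions_def)
  qed
  then have eq: "inversions [(\<alpha>, of_int k)] = Sigma \<Phi> (\<lambda>\<beta>. of_int ` {lo \<beta>..hi \<beta>})"
  proof (intro equalityI subsetI)
    fix b assume b: "b \<in> inversions [(\<alpha>, of_int k)]"
    then have "b \<in> \<Phi> \<times> \<int>" by (simp add: inversions_def pos_affine_def affine_roots_def)
    then obtain \<beta> j where "\<beta> \<in> \<Phi>" "b = (\<beta>, of_int j)" by (auto elim: Ints_cases)
    with mem b show "b \<in> Sigma \<Phi> (\<lambda>\<beta>. of_int ` {lo \<beta>..hi \<beta>})" by simp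
  qed (use mem in auto)
  show ?fin unfolding eq using finite_roots by (intro finite_SigmaI) auto
  have "int (card (inversions [(\<alpha>, of_int k)])) = (\<Sum>\<beta>\<in>\<Phi>. int (nat (hi \<beta> - lo \<beta> + 1)))"
    unfolding eq using finite_roots by (simp add: card_image inj_on_def add.commute)
  also have "\<dots> = (\<Sum>\<beta>\<in>pos_roots. int (nat (hi \<beta> - lo \<beta> + 1)) + int (nat (hi (- \<beta>) - lo (- \<beta>) + 1)))"
    by (rule sum_roots)
  also have "\<dots> = (\<Sum>\<beta>\<in>pos_roots. if s \<beta> \<in> pos_roots
        then \<bar>int_pairing \<alpha> \<beta> * k\<bar> else \<bar>int_pairing \<alpha> \<beta> * k + 1\<bar>)"
  \<comment> \<open>At most one of the intervals for \<beta> and - \<beta> is nonempty. With x the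
    shift of levels their sizes are max 0 x and max 0 (-x), or the same with x + 1, and add up to an
    absolute value.\<close>
  proof (rule sum.cong[OF refl])
    fix \<beta> assume "\<beta> \<in> pos_roots"
    moreover from this have \<beta>: "\<beta> \<in> \<Phi>" using pos_roots_subset by blast
    moreover define x where "x = int_pairing \<alpha> \<beta> * k"
    moreover have "int_pairing \<alpha> (- \<beta>) * k = - x"
      by (simp add: x_def int_pairing_uminus assms \<beta>)
    ultimately show "int (nat (hi \<beta> - lo \<beta> + 1)) + int (nat (hi (- \<beta>) - lo (- \<beta>) + 1)) =
        (if s \<beta> \<in> pos_roots then \<bar>int_pairing \<alpha> \<beta> * k\<bar> else \<bar>int_pairing \<alpha> \<beta> * k + 1\<bar>)"
      using pos_roots_disjoint[of \<beta>]
      by (simp add: hi_def lo_def s neg flip: x_def)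
  qed
  finally show ?card by (simp add: s_def)
qed

text \<open>Subtracting a nonpositive multiple of a positive root cannot make a coefficient
  negative. This fixes the sign inside the absolute values wherever a term + 1 occurs.\<close>

lemma int_pairing_pos:
  assumes "\<alpha> \<in> pos_roots" "\<beta> \<in> pos_roots" "\<beta> - pairing \<alpha> \<beta> *\<^sub>R \<alpha> \<notin> pos_roots"
  shows "0 < int_pairing \<alpha> \<beta>"
proof (rule ccontr)
  assume "\<not> ?thesis"
  moreover have roots: "\<alpha> \<in> \<Phi>" "\<beta> \<in> \<Phi>" using assms pos_roots_subset by auto
  ultimately have "pairing \<alpha> \<beta> \<le> 0"
    by (metis of_int_int_pairing of_int_0_less_iff not_less)
  then have "pairing \<alpha> \<beta> * coef \<delta> \<alpha> \<le> 0" if "\<delta> \<in> \<Delta>" for \<delta>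
    using that assms(1) by (intro mult_nonpos_nonneg) (auto simp: pos_roots_def)
  then have "0 \<le> coef \<delta> \<beta> - pairing \<alpha> \<beta> * coef \<delta> \<alpha>" if "\<delta> \<in> \<Delta>" for \<delta>
    using that assms(2) by (force simp: pos_roots_def intro: order_trans)
  then show False
    using assms(3) roots reflect_root by (auto simp: pos_roots_def coef_linear)
qed

text \<open>To be used with c = 1 for roots (\<alpha>, k) and with c = -1 for roots (- \<alpha>,
  k).\<close>

lemma sum_slope_offset:
  "k * slope \<alpha> + c * offset \<alpha> = (\<Sum>\<beta>\<in>pos_roots. if \<beta> - pairing \<alpha> \<beta> *\<^sub>R \<alpha> \<in> pos_roots
     then \<bar>int_pairing \<alpha> \<beta>\<bar> * k else \<bar>int_pairing \<alpha> \<beta>\<bar> * k + c)"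
proof -
  have "offset \<alpha> = (\<Sum>\<beta>\<in>pos_roots. if \<beta> - pairing \<alpha> \<beta> *\<^sub>R \<alpha> \<notin> pos_roots then 1 else 0)"
    using finite_pos_roots by (simp add: offset_def flip: sum.inter_filter)
  then show ?thesis
    by (simp add: slope_def sum_distrib_left flip: sum.distrib) (intro sum.cong, auto)
qed

lemma card_inversions_pos:
  assumes "\<alpha> \<in> pos_roots" "0 \<le> k"
  shows "int (card (inversions [(\<alpha>, of_int k)])) = k * slope \<alpha> + offset \<alpha>"
proof -
  have "k * slope \<alpha> + 1 * offset \<alpha> = int (card (inversions [(\<alpha>, of_int k)]))"
    unfolding sum_slope_offset inversions_reflection(2)[OF subsetD[OF pos_roots_subset assms(1)]]
  proof (intro sum.cong refl)
    fix \<beta> assume \<beta>: "\<beta> \<in> pos_roots"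
    have "0 \<le> int_pairing \<alpha> \<beta> * k" if "\<beta> - pairing \<alpha> \<beta> *\<^sub>R \<alpha> \<notin> pos_roots"
      using int_pairing_pos[OF assms(1) \<beta> that] assms(2) by simp
    then show "(if \<beta> - pairing \<alpha> \<beta> *\<^sub>R \<alpha> \<in> pos_roots then \<bar>int_pairing \<alpha> \<beta>\<bar> * k
        else \<bar>int_pairing \<alpha> \<beta>\<bar> * k + 1) =
       (if \<beta> - pairing \<alpha> \<beta> *\<^sub>R \<alpha> \<in> pos_roots then \<bar>int_pairing \<alpha> \<beta> * k\<bar>
        else \<bar>int_pairing \<alpha> \<beta> * k + 1\<bar>)"
      using int_pairing_pos[OF assms(1) \<beta>] assms(2) by (auto simp: abs_mult)
  qed
  then show ?thesis by simp
qed

text \<open>Passing to - \<alpha> negates the pairing and leaves the finite reflection unchanged.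
  With p the pairing for \<alpha>, the special terms are |1 - p k| = p k - 1, because p and k are at
  least 1.\<close>

lemma card_inversions_neg:
  assumes "\<alpha> \<in> pos_roots" "1 \<le> k"
  shows "int (card (inversions [(- \<alpha>, of_int k)])) = k * slope \<alpha> - offset \<alpha>"
proof -
  have \<alpha>: "\<alpha> \<in> \<Phi>" using assms pos_roots_subset by auto
  have "k * slope \<alpha> + (-1) * offset \<alpha> = int (card (inversions [(- \<alpha>, of_int k)]))"
    unfolding sum_slope_offset inversions_reflection(2)[OF uminus_root[OF \<alpha>]]
  proof (intro sum.cong refl)
    fix \<beta> assume \<beta>: "\<beta> \<in> pos_roots"
    then have n: "int_pairing (- \<alpha>) \<beta> = - int_pairing \<alpha> \<beta>"
      using int_pairing_uminus \<alpha> pos_roots_subset by blast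
    have "1 \<le> int_pairing \<alpha> \<beta> * k" if "\<beta> - pairing \<alpha> \<beta> *\<^sub>R \<alpha> \<notin> pos_roots"
      using int_pairing_pos[OF assms(1) \<beta> that] assms(2) mult_mono[of 1 "int_pairing \<alpha> \<beta>" 1 k] by simp
    then show "(if \<beta> - pairing \<alpha> \<beta> *\<^sub>R \<alpha> \<in> pos_roots then \<bar>int_pairing \<alpha> \<beta>\<bar> * k
        else \<bar>int_pairing \<alpha> \<beta>\<bar> * k + - 1) =
       (if \<beta> - pairing (- \<alpha>) \<beta> *\<^sub>R - \<alpha> \<in> pos_roots then \<bar>int_pairing (- \<alpha>) \<beta> * k\<bar>
        else \<bar>int_pairing (- \<alpha>) \<beta> * k + 1\<bar>)"
      using int_pairing_pos[OF assms(1) \<beta>] assms(2)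
      by (auto simp: n pairing_uminus abs_mult)
  qed
  then show ?thesis by simp
qed

text \<open>The map b \<mapsto> - \<open>act a b\<close> is an involution on the inversions, and by
  \<open>act_eq_uminus_iff\<close> its only fixed point is \<open>a\<close>.\<close>

lemma odd_card_inversions:
  assumes "a \<in> pos_affine" shows "odd (card (inversions [a]))"
proof (rule odd_card_involution[where f = "\<lambda>b. - act a b" and a = a])
  have a: "fst a \<in> \<Phi>" "fst a \<noteq> 0"
    using assms pos_affine_root fst_affine_root by blast+
  obtain k :: int where "snd a = of_int k"
    using assms by (auto simp: pos_affine_def affine_roots_def elim: Ints_cases)
  then show "finite (inversions [a])"
    using inversions_reflection(1)[OF a(1), of k] by (metis prod.collapse)
  show "a \<in> inversions [a]" using assms a by (simp add: inversions_def act_self)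
  show "- act a b = b \<longleftrightarrow> b = a" if "b \<in> inversions [a]" for b
    using that act_eq_uminus_iff[OF assms, of b] by (auto simp: inversions_def minus_equation_iff)
qed (use assms pos_affine_root fst_affine_root(2) in \<open>auto simp: inversions_def act_uminus act_act\<close>)

text \<open>The reflections in (\<alpha>, 0) and (- \<alpha>, 1) have \<open>offset\<close> and
  \<open>slope - offset\<close> inversions. Both counts are odd, hence positive.\<close>

lemma slope_offset:
  assumes "\<alpha> \<in> pos_roots"
  shows "odd (offset \<alpha>)" "even (slope \<alpha>)" "0 < offset \<alpha>" "offset \<alpha> < slope \<alpha>"
proof -
  have \<alpha>: "\<alpha> \<in> \<Phi>" using assms pos_roots_subset by auto
  have "odd (int (card (inversions [(\<alpha>, of_int 0)])))"
    using assms \<alpha> by (simp add: odd_card_inversions pos_affine_iff affine_roots_def)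
  then show o: "odd (offset \<alpha>)" unfolding card_inversions_pos[OF assms order_refl] by simp
  have o': "odd (int (card (inversions [(- \<alpha>, of_int 1)])))"
    using \<alpha> uminus_root by (simp add: odd_card_inversions pos_affine_iff affine_roots_def)
  then have "odd (1 * slope \<alpha> - offset \<alpha>)" unfolding card_inversions_neg[OF assms order_refl] .
  then show "even (slope \<alpha>)" using o by simp
  show "0 < offset \<alpha>" using o by (cases "offset \<alpha> = 0") (auto simp: offset_def)
  have "card (inversions [(- \<alpha>, of_int 1)]) \<noteq> 0" using o' by (intro notI) simp
  then show "offset \<alpha> < slope \<alpha>" using card_inversions_neg[OF assms, of 1] by simp
qed

text \<open>Provides a reflection of length 1, which makes the constant term of P nonzero.\<close>

lemma offset_simple: "\<delta> \<in> \<Delta> \<Longrightarrow> offset \<delta> = 1"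
proof -
  assume \<delta>: "\<delta> \<in> \<Delta>"
  then have pos: "\<delta> \<in> pos_roots" and a: "(\<delta>, 0) \<in> simple_affine"
    using simple_roots by (auto simp: pos_roots_def coef_simple simple_affine_def)
  have "inversions [(\<delta>, 0)] = {(\<delta>, 0)}"
  proof (intro equalityI subsetI)
    fix b assume b: "b \<in> inversions [(\<delta>, 0)]"
    show "b \<in> {(\<delta>, 0)}"
    proof (rule ccontr)
      assume "b \<notin> {(\<delta>, 0)}"
      then have "act (\<delta>, 0) b \<in> pos_affine"
        using act_simple_pos[OF a, of b] b by (auto simp: inversions_def)
      then show False using b pos_affine_disjoint[of "act (\<delta>, 0) b"] by (simp add: inversions_def)
    qed
  next
    have "act (\<delta>, 0) (\<delta>, 0) = - (\<delta>, 0)"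
      using fst_affine_root(2)[OF pos_affine_root[OF simple_affine_pos[OF a]]] by (rule act_self)
    then show "b \<in> inversions [(\<delta>, 0)]" if "b \<in> {(\<delta>, 0)}" for b
      using simple_affine_pos[OF a] that by (auto simp: inversions_def)
  qed
  then show "offset \<delta> = 1" using card_inversions_pos[OF pos, of 0] by simp
qed

text \<open>Solve n = k N + L and n = k N - L for the level k. The differences are taken in the
  integers, since n - L may be negative.\<close>

lemma inversions_level_set:
  "{b \<in> pos_affine. card (inversions [b]) = n} =
    (\<lambda>\<alpha>. (\<alpha>, of_int ((int n - offset \<alpha>) div slope \<alpha>))) ` {\<alpha> \<in> pos_roots. slope \<alpha> dvd int n - offset \<alpha>} \<union>
    (\<lambda>\<alpha>. (- \<alpha>, of_int ((int n + offset \<alpha>) div slope \<alpha>))) ` {\<alpha> \<in> pos_roots. slope \<alpha> dvd int n + offset \<alpha>}"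
    (is "?L = ?f ` ?A \<union> ?g ` ?B")
proof (intro equalityI subsetI)
  fix b assume b: "b \<in> ?L"
  then obtain k :: int where k: "snd b = of_int k"
    by (auto simp: pos_affine_def affine_roots_def elim: Ints_cases)
  have "fst b \<in> \<Phi>" using b pos_affine_root fst_affine_root by blast
  then consider "fst b \<in> pos_roots" "0 \<le> k" | "- fst b \<in> pos_roots" "1 \<le> k"
    using b k root_sign[of "fst b"] pos_roots_disjoint[of "fst b"] pos_affine_root[of b]
    by (auto simp: pos_affine_iff)
  then show "b \<in> ?f ` ?A \<union> ?g ` ?B"
  proof cases
    case 1
    then have n: "int n = k * slope (fst b) + offset (fst b)"
      using card_inversions_pos[OF 1] b k by (metis (mono_tags, lifting) mem_Collect_eq prod.collapse)
    moreover have "slope (fst b) \<noteq> 0" using slope_offset[OF 1(1)] by simp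
    ultimately have "b = ?f (fst b)" "fst b \<in> ?A" using k 1 by (auto simp: prod_eq_iff)
    then show ?thesis by blast
  next
    case 2
    then have n: "int n = k * slope (- fst b) - offset (- fst b)"
      using card_inversions_neg[OF 2] b k by (metis (mono_tags, lifting) mem_Collect_eq prod.collapse minus_minus)
    moreover have "slope (- fst b) \<noteq> 0" using slope_offset[OF 2(1)] by simp
    ultimately have "b = ?g (- fst b)" "- fst b \<in> ?B" using k 2 by (auto simp: prod_eq_iff)
    then show ?thesis by blast
  qed
next
  fix b assume "b \<in> ?f ` ?A \<union> ?g ` ?B"
  then show "b \<in> ?L"
  proof
    assume "b \<in> ?f ` ?A"
    then obtain \<alpha> where A: "\<alpha> \<in> ?A" "b = ?f \<alpha>" by blast
    then obtain k where "int n - offset \<alpha> = slope \<alpha> * k" by blast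
    with A have \<alpha>: "\<alpha> \<in> pos_roots" "int n - offset \<alpha> = slope \<alpha> * k" "b = ?f \<alpha>" by auto
    note so = slope_offset[OF \<alpha>(1)]
    have b: "b = (\<alpha>, of_int k)" using \<alpha> so by simp
    \<comment> \<open>Since n is nonnegative and L < N, the multiple n - L of N exceeds -N, so k >
      -1.\<close>
    have "slope \<alpha> * k > - slope \<alpha>" using \<alpha>(2) so by linarith
    then have "slope \<alpha> * (k + 1) > 0" by (simp add: algebra_simps)
    then have k: "0 \<le> k" using so by (simp add: zero_less_mult_iff)
    have "(\<alpha>, of_int k) \<in> affine_roots" using \<alpha>(1) pos_roots_subset by (auto simp: affine_roots_def)
    then have "b \<in> pos_affine" using \<alpha>(1) k by (auto simp: b pos_affine_iff)
    then show "b \<in> ?L"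
      using \<alpha>(2) card_inversions_pos[OF \<alpha>(1) k] by (simp add: b mult.commute)
  next
    assume "b \<in> ?g ` ?B"
    then obtain \<alpha> where A: "\<alpha> \<in> ?B" "b = ?g \<alpha>" by blast
    then obtain k where "int n + offset \<alpha> = slope \<alpha> * k" by blast
    with A have \<alpha>: "\<alpha> \<in> pos_roots" "int n + offset \<alpha> = slope \<alpha> * k" "b = ?g \<alpha>" by auto
    note so = slope_offset[OF \<alpha>(1)]
    have b: "b = (- \<alpha>, of_int k)" using \<alpha> so by simp
    have "slope \<alpha> * k > 0" using \<alpha>(2) so by linarith
    then have "1 \<le> k" using so by (simp add: zero_less_mult_iff)
    then show "b \<in> ?L"
      using \<alpha> b card_inversions_neg[OF \<alpha>(1), of k] pos_roots_subset
      by (auto simp: pos_affine_iff affine_roots_def mult.commute uminus_root)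
  qed
qed

lemma card_level_set:
  "finite {b \<in> pos_affine. card (inversions [b]) = n}"
  "card {b \<in> pos_affine. card (inversions [b]) = n} =
    card {\<alpha> \<in> pos_roots. slope \<alpha> dvd int n - offset \<alpha>} +
    card {\<alpha> \<in> pos_roots. slope \<alpha> dvd int n + offset \<alpha>}"
proof -
  show "finite {b \<in> pos_affine. card (inversions [b]) = n}"
    unfolding inversions_level_set using finite_pos_roots by simp
  show "card {b \<in> pos_affine. card (inversions [b]) = n} =
    card {\<alpha> \<in> pos_roots. slope \<alpha> dvd int n - offset \<alpha>} +
    card {\<alpha> \<in> pos_roots. slope \<alpha> dvd int n + offset \<alpha>}"
    unfolding inversions_level_set using finite_pos_roots pos_roots_disjoint
    by (subst card_Un_disjoint) (auto simp: card_image inj_on_def)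
qed

section \<open>The generating function\<close>

theorem reflection_length_series:
  "\<exists>(M::nat) (P::int poly). M \<ge> 1 \<and> palindromic P \<and>
     ((\<lambda>t. fps_X ^ coxeter_length weyl gens t) has_sum
        (fps_X * (fps_of_poly (map_poly rat_of_int P) oo fps_X ^ 2)
           / (1 - fps_X ^ (2 * M)) :: rat fps))
       (coxeter_reflections weyl gens)"
proof -
  define c where "c n = card {b \<in> pos_affine. card (inversions [b]) = n}" for n
  have c_eq: "c n = card {\<alpha> \<in> pos_roots. slope \<alpha> dvd int n - offset \<alpha>} +
      card {\<alpha> \<in> pos_roots. slope \<alpha> dvd int n + offset \<alpha>}" for n
    unfolding c_def by (rule card_level_set)
  have pos: "0 < slope \<alpha>" "even (slope \<alpha>)" if "\<alpha> \<in> pos_roots" for \<alpha>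
    using slope_offset[OF that] by auto
  obtain \<delta> where \<delta>: "\<delta> \<in> \<Delta>"
  proof -
    have "\<Delta> \<noteq> {}"
      using span_simple nonempty zero_notin_roots by auto
    then show ?thesis using that by blast
  qed
  then have \<delta>_pos: "\<delta> \<in> pos_roots" using simple_roots by (auto simp: pos_roots_def coef_simple)
  \<comment> \<open>Any positive common multiple of the slopes would do; the product is even because
    the slope of \<delta> divides it.\<close>
  define K where "K = (\<Prod>\<alpha>\<in>pos_roots. slope \<alpha>)"
  have dvd_K: "slope \<alpha> dvd K" if "\<alpha> \<in> pos_roots" for \<alpha>
    unfolding K_def using finite_pos_roots that by (rule dvd_prodI)
  have "0 < K" unfolding K_def using pos by (intro prod_pos) auto
  moreover have "even K" using dvd_K[OF \<delta>_pos] pos(2)[OF \<delta>_pos] dvd_trans by blast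
  ultimately obtain m where "K = 2 * m" "0 < m" by (auto elim: evenE)
  then obtain M :: nat where M: "K = 2 * int M" "M \<ge> 1"
    using that[of "nat m"] by simp
  have "\<exists>P::int poly. palindromic P \<and>
    Abs_fps (\<lambda>n. of_nat (c n)) =
      (fps_X * (fps_of_poly (map_poly rat_of_int P) oo fps_X ^ 2) / (1 - fps_X ^ (2 * M)) :: rat fps)"
  proof (rule palindromic_quotient_of_symmetric_sequence[OF M(2)])
    show "c n = 0" if "even n" for n
    proof -
      have "\<not> slope \<alpha> dvd int n - offset \<alpha>" "\<not> slope \<alpha> dvd int n + offset \<alpha>" if "\<alpha> \<in> pos_roots" for \<alpha>
      proof -
        have "odd (int n - offset \<alpha>)" "odd (int n + offset \<alpha>)"
          using slope_offset(1)[OF that] \<open>even n\<close> by simp_all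
        then show "\<not> slope \<alpha> dvd int n - offset \<alpha>" "\<not> slope \<alpha> dvd int n + offset \<alpha>"
          using slope_offset(2)[OF that] dvd_trans by blast+
      qed
      then show ?thesis by (simp add: c_eq cong: conj_cong)
    qed
    show "c (n + 2 * M) = c n" for n
    proof -
      have "slope \<alpha> dvd int (n + 2 * M) - offset \<alpha> \<longleftrightarrow> slope \<alpha> dvd int n - offset \<alpha>"
        "slope \<alpha> dvd int (n + 2 * M) + offset \<alpha> \<longleftrightarrow> slope \<alpha> dvd int n + offset \<alpha>"
        if "\<alpha> \<in> pos_roots" for \<alpha>
        using dvd_K[OF that] dvd_add_left_iff[of "slope \<alpha>" K "int n - offset \<alpha>"]
          dvd_add_left_iff[of "slope \<alpha>" K "int n + offset \<alpha>"]
        by (simp_all add: M(1) algebra_simps)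
      then show ?thesis by (simp add: c_eq cong: conj_cong)
    qed
    \<comment> \<open>Modulo each slope, n \<mapsto> 2M - n is negation and exchanges the two
      divisibility conditions.\<close>
    show "c (2 * M - n) = c n" if "n \<le> 2 * M" for n
    proof -
      have "slope \<alpha> dvd int (2 * M - n) - offset \<alpha> \<longleftrightarrow> slope \<alpha> dvd int n + offset \<alpha>"
        "slope \<alpha> dvd int (2 * M - n) + offset \<alpha> \<longleftrightarrow> slope \<alpha> dvd int n - offset \<alpha>"
        if "\<alpha> \<in> pos_roots" for \<alpha>
      proof -
        have "int (2 * M - n) - offset \<alpha> = K - (int n + offset \<alpha>)"
          "int (2 * M - n) + offset \<alpha> = K - (int n - offset \<alpha>)"
          using \<open>n \<le> 2 * M\<close> by (simp_all add: M(1))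
        then show "slope \<alpha> dvd int (2 * M - n) - offset \<alpha> \<longleftrightarrow> slope \<alpha> dvd int n + offset \<alpha>"
          "slope \<alpha> dvd int (2 * M - n) + offset \<alpha> \<longleftrightarrow> slope \<alpha> dvd int n - offset \<alpha>"
          using dvd_K[OF that] by (simp_all only: dvd_diff_right_iff)
      qed
      then show ?thesis by (simp add: c_eq cong: conj_cong)
    qed
    have "\<delta> \<in> {\<alpha> \<in> pos_roots. slope \<alpha> dvd int 1 - offset \<alpha>}"
      using \<delta>_pos offset_simple[OF \<delta>] by simp
    then show "c 1 \<noteq> 0" using finite_pos_roots by (auto simp: c_eq)
  qed
  moreover have "((\<lambda>t. fps_X ^ coxeter_length weyl gens t) has_sum
      (Abs_fps (\<lambda>n. of_nat (c n)) :: rat fps)) (coxeter_reflections weyl gens)"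
  proof -
    have "((\<lambda>b. fps_X ^ card (inversions [b]) :: rat fps) has_sum Abs_fps (\<lambda>n. of_nat (c n))) pos_affine"
      unfolding c_def by (rule has_sum_fps_X_power) (rule card_level_set(1))
    then show ?thesis
      unfolding coxeter_reflections_eq has_sum_reindex[OF inj_on_reflection]
      by (rule has_sum_cong[THEN iffD1, rotated]) (simp add: coxeter_length_reflection)
  qed
  ultimately show ?thesis using M(2) by metis
qed

end

theorem theorem1p2:
  fixes W :: "('a::euclidean_space \<Rightarrow> 'a) monoid" and S :: "('a \<Rightarrow> 'a) set"
  assumes "affine_coxeter_system W S"
  shows "\<exists>(M::nat) (P::int poly). M \<ge> 1 \<and> palindromic P \<and>
           ((\<lambda>t. fps_X ^ coxeter_length W S t) has_sum
              (fps_X * (fps_of_poly (map_poly rat_of_int P) oo fps_X ^ 2)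
                 / (1 - fps_X ^ (2 * M)) :: rat fps))
             (coxeter_reflections W S)"
proof -
  obtain \<Phi> \<Delta> \<theta> where "root_system \<Phi>" "reduced_roots \<Phi>" "crystallographic \<Phi>" "irreducible_roots \<Phi>"
      "simple_system \<Phi> \<Delta>" "highest_root \<Phi> \<Delta> \<theta>"
      and WS: "W = affine_weyl_group \<Phi>" "S = simple_affine_reflections \<Delta> \<theta>"
    using assms unfolding affine_coxeter_system_def by blast
  then interpret affine_root_datum \<Phi> \<Delta> \<theta>
    by unfold_locales (auto simp: irreducible_roots_def)
  show ?thesis unfolding WS by (rule reflection_length_series)
qed

end
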